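(* Let $\sigma\in\{1,-1\}$, let $q_0\in H^{1,1}(\mathbb{R})$ be generic, and let $q(x,t)$ be the solution of $iq_t(x,t)+q_{xx}(x,t)+2\sigma q^2(x,t)\overline{q(-x,t)}=0$, $q(x,0)=q_0(x)$. Let $\Phi^\pm=(\Phi^\pm_1,\Phi^\pm_2)$ be the modified Jost solutions, $a,\breve a,b,\breve b$ the scattering coefficients, and $r=b/a$, $\breve r=\breve b/\breve a$ on $\mathbb{R}$ the reflection coefficients. Assume $a$ has no zero in $\mathbb{C}_+=\{\operatorname{Im}z>0\}$ and $\breve a$ has no zero in $\mathbb{C}_-=\{\operatorname{Im}z<0\}$. Define $$M\equiv M(z;x,t)=\begin{cases}\left(\dfrac{\Phi_1^-(z;x,t)}{a(z)},\ \Phi_2^+(z;x,t)\right),& z\in\mathbb{C}_+,\\[2mm] \left(\Phi_1^+(z;x,t),\ \dfrac{\Phi_2^-(z;x,t)}{\breve a(z)}\right),& z\in\mathbb{C}_-.\end{cases}$$ Then $M$ solves the following Riemann-Hilbert problem: find a $2\times2$ matrix function $M$ on $\mathbb{C}\setminus\mathbb{R}$ such that (i) Analyticity: $M$ is holomorphic on $\mathbb{C}\setminus\mathbb{R}$; (ii) Normalization: $M\sim I+\mathcal{O}(z^{-1})$ as $z\to\infty$; (iii) Jump condition: $M_+=M_-V$ on $\mathbb{R}$, where $M_\pm$ are the boundary values of $M$ from $\mathbb{C}_\pm$ and $$V=e^{t\varphi\hat\sigma_3}\begin{pmatrix}1-r\breve r&-\breve r\\ r&1\end{pmatrix},\qquad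 \varphi=\varphi(z;x,t)=i\left(\frac{zx}{t}+2z^2\right).$$
   Context: $H^{1,1}(\mathbb{R})=L^{2,1}(\mathbb{R})\cap H^1(\mathbb{R})$ with $L^{2,1}(\mathbb{R})=\{f:(1+|\cdot|^2)^{1/2}f\in L^2(\mathbb{R})\}$. Let $\sigma_3=\mathrm{diag}(1,-1)$ and $e^{c\hat\sigma_3}A=e^{c\sigma_3}Ae^{-c\sigma_3}$ for a $2\times 2$ matrix $A$. The equation has the Lax pair $\phi_x+iz\sigma_3\phi=Q\phi$, $\phi_t+2iz^2\sigma_3\phi=P\phi$, with $Q=\begin{pmatrix}0&q(x,t)\\ -\sigma\overline{q(-x,t)}&0\end{pmatrix}$ and $P=i\sigma_3(Q_x-Q^2)+2zQ$. The Jost solutions $\phi^\pm(z;x,t)$ are the solutions of the Lax pair with $\phi^\pm\sim e^{-t\varphi\sigma_3}$ as $x\to\pm\infty$, where $\varphi=i(zx/t+2z^2)$, and the modified Jost solutions are $\Phi^\pm=\phi^\pm e^{t\varphi\sigma_3}$, so that $\Phi^\pm\to I$ as $x\to\pm\infty$. The columns $\Phi^-_1,\Phi^+_2$ are analytic in $z$ on $\mathbb{C}_+$ and $\Phi^+_1,\Phi^-_2$ are analytic on $\mathbb{C}_-$, all extending continuously to $\mathbb{R}$. The scattering matrix $S(z)=\begin{pmatrix}a(z)&\breve b(z)\\ b(z)&\breve a(z)\end{pmatrix}$, independent of $(x,t)$, is defined by $\phi^-=\phi^+S$; here $a=\det(\Phi_1^-,\Phi_2^+)$ is analytic on $\mathbb{C}_+$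 and $\breve a=\det(\Phi_1^+,\Phi_2^-)$ is analytic on $\mathbb{C}_-$, both continuous up to $\mathbb{R}$. The potential $q_0$ is called generic if the reflection coefficients have no singular point along the continuous spectrum $\mathbb{R}$.
   Formalization: The jump matrix V uses e^{-tφσ̂3} instead of e^{tφσ̂3}, as the given conventions force; (ii) is stated as M→I as z→∞ off the real line, with rate O(1/z) on |Im z|≥δ for every δ>0, since a rate uniform up to the line fails for general H^{1,1} data. *)

theory Defs
  imports "HOL-Analysis.Analysis" "HOL-Library.Landau_Symbols"
begin

section \<open>Matrices\<close>

definition mat2 :: "complex \<Rightarrow> complex \<Rightarrow> complex \<Rightarrow> complex \<Rightarrow> complex^2^2" where
  "mat2 a b c d = vector [vector [a, b], vector [c, d]]"

definition of_cols :: "complex^2 \<Rightarrow> complex^2 \<Rightarrow> complex^2^2" where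
  "of_cols u v = (\<chi> i j. if j = 1 then u $ i else v $ i)"

definition sigma3 :: "complex^2^2" where
  "sigma3 = mat2 1 0 0 (-1)"

text \<open>The matrix \<open>e\<close> to the power \<open>c \<sigma>\<^sub>3\<close>, and its conjugation action on 2 by 2 matrices.\<close>

definition exp_sigma3 :: "complex \<Rightarrow> complex^2^2" where
  "exp_sigma3 c = mat2 (exp c) 0 0 (exp (- c))"

definition exp_hat_sigma3 :: "complex \<Rightarrow> complex^2^2 \<Rightarrow> complex^2^2" where
  "exp_hat_sigma3 c A = exp_sigma3 c ** A ** exp_sigma3 (- c)"


section \<open>The weighted Sobolev space\<close>

definition L2 :: "(real \<Rightarrow> complex) \<Rightarrow> bool" where
  "L2 f \<longleftrightarrow> f \<in> borel_measurable lebesgue \<and> integrable lebesgue (\<lambda>x. (norm (f x))\<^sup>2)"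

definition L21 :: "(real \<Rightarrow> complex) \<Rightarrow> bool" where
  "L21 f \<longleftrightarrow> L2 (\<lambda>x. sqrt (1 + x\<^sup>2) *\<^sub>R f x)"

abbreviation Dx :: "(real \<Rightarrow> complex) \<Rightarrow> real \<Rightarrow> complex" where
  "Dx f \<equiv> (\<lambda>x. vector_derivative f (at x))"

text \<open>
  Elements of the Sobolev space are identified with their (unique) continuous representatives:
  locally absolutely continuous functions in \<open>L\<^sup>2\<close> whose almost everywhere derivative is in
  \<open>L\<^sup>2\<close>.  The last conjunct below is the absolute continuity; it forces \<open>f\<close> to be
  differentiable almost everywhere, so the arbitrary value of \<^const>\<open>vector_derivative\<close> at
  points of non-differentiability is irrelevant.
\<close>

definition H1 :: "(real \<Rightarrow> complex) \<Rightarrow> bool" where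
  "H1 f \<longleftrightarrow> L2 f \<and> L2 (Dx f) \<and>
     (\<forall>a b. a \<le> b \<longrightarrow> (Dx f has_integral (f b - f a)) {a..b})"

definition H11 :: "(real \<Rightarrow> complex) \<Rightarrow> bool" where
  "H11 f \<longleftrightarrow> L21 f \<and> H1 f"

definition H11_norm :: "(real \<Rightarrow> complex) \<Rightarrow> real" where
  "H11_norm f = sqrt ((LINT x|lebesgue. (1 + x\<^sup>2) * (norm (f x))\<^sup>2) +
                      (LINT x|lebesgue. (norm (Dx f x))\<^sup>2))"


section \<open>The nonlocal nonlinear Schroedinger equation\<close>

definition test_function :: "(real \<Rightarrow> real) \<Rightarrow> bool" where
  "test_function \<psi> \<longleftrightarrow> (\<forall>n. (deriv ^^ n) \<psi> differentiable_on UNIV) \<and>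
                       compact (closure {x. \<psi> x \<noteq> 0})"

text \<open>
  \<open>q\<close> is a function of \<open>x\<close> and then \<open>t\<close>; \<open>J\<close> is the time interval of existence.  For data in
  this space there are no classical second derivatives: a solution is a continuous curve in
  \<^const>\<open>H11\<close> that solves \<open>i q\<^sub>t + q\<^sub>x\<^sub>x + 2 \<sigma> q\<^sup>2 (cnj q(-x,t)) = 0\<close> weakly in \<open>x\<close> and
  integrated in \<open>t\<close>.
\<close>

definition nonlocal_nls_solution ::
  "real \<Rightarrow> real set \<Rightarrow> (real \<Rightarrow> complex) \<Rightarrow> (real \<Rightarrow> real \<Rightarrow> complex) \<Rightarrow> bool" where
  "nonlocal_nls_solution \<sigma> J q0 q \<longleftrightarrow>
     (\<forall>t\<in>J. H11 (\<lambda>x. q x t)) \<and>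
     (\<forall>t\<in>J. ((\<lambda>s. H11_norm (\<lambda>x. q x s - q x t)) \<longlongrightarrow> 0) (at t within J)) \<and>
     (\<forall>x. q x 0 = q0 x) \<and>
     (\<forall>\<psi>. test_function \<psi> \<longrightarrow> (\<forall>t1\<in>J. \<forall>t2\<in>J. t1 \<le> t2 \<longrightarrow>
        \<i> * ((LINT x|lebesgue. \<psi> x *\<^sub>R q x t2) - (LINT x|lebesgue. \<psi> x *\<^sub>R q x t1)) +
        integral {t1..t2} (\<lambda>t. LINT x|lebesgue.
            deriv (deriv \<psi>) x *\<^sub>R q x t
            + \<psi> x *\<^sub>R (2 * of_real \<sigma> * (q x t)\<^sup>2 * cnj (q (- x) t))) = 0))"


section \<open>Lax pair and Jost solutions\<close>

definition Qmat :: "real \<Rightarrow> (real \<Rightarrow> real \<Rightarrow> complex) \<Rightarrow> real \<Rightarrow> real \<Rightarrow> complex^2^2" where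
  "Qmat \<sigma> q x t = mat2 0 (q x t) (- of_real \<sigma> * cnj (q (- x) t)) 0"

definition Pmat ::
  "real \<Rightarrow> (real \<Rightarrow> real \<Rightarrow> complex) \<Rightarrow> complex \<Rightarrow> real \<Rightarrow> real \<Rightarrow> complex^2^2" where
  "Pmat \<sigma> q z x t =
     mat \<i> ** sigma3 ** (vector_derivative (\<lambda>y. Qmat \<sigma> q y t) (at x) - Qmat \<sigma> q x t ** Qmat \<sigma> q x t)
     + mat (2 * z) ** Qmat \<sigma> q x t"

text \<open>
  A vector solution of the Lax pair.  The potential is continuous, so the \<open>x\<close>-equation holds
  classically.  The matrix \<^const>\<open>Pmat\<close> contains \<open>q\<^sub>x\<close>, which only exists almost everywhere, so the
  \<open>t\<close>-equation is required in integrated (Caratheodory) form for almost every \<open>x\<close>.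
\<close>

definition lax_pair_solution ::
  "real \<Rightarrow> real set \<Rightarrow> (real \<Rightarrow> real \<Rightarrow> complex) \<Rightarrow> complex \<Rightarrow> (real \<Rightarrow> real \<Rightarrow> complex^2) \<Rightarrow> bool" where
  "lax_pair_solution \<sigma> J q z \<phi> \<longleftrightarrow>
     (\<forall>t\<in>J. \<forall>x. ((\<lambda>y. \<phi> y t) has_vector_derivative
         ((Qmat \<sigma> q x t - mat (\<i> * z) ** sigma3) *v \<phi> x t)) (at x)) \<and>
     (AE x in lebesgue. \<forall>t1\<in>J. \<forall>t2\<in>J. t1 \<le> t2 \<longrightarrow>
         (let F = (\<lambda>t. (Pmat \<sigma> q z x t - mat (2 * \<i> * z\<^sup>2) ** sigma3) *v \<phi> x t)
          in F absolutely_integrable_on {t1..t2} \<and>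
             (F has_integral (\<phi> x t2 - \<phi> x t1)) {t1..t2}))"

text \<open>
  \<open>phase z x t\<close> is \<open>t \<cdot> \<phi>(z;x,t)\<close> for \<open>\<phi> = i (z x / t + 2 z\<^sup>2)\<close>, with the division by \<open>t\<close>
  cancelled so that it also makes sense at \<open>t = 0\<close>.
\<close>

definition phase :: "complex \<Rightarrow> real \<Rightarrow> real \<Rightarrow> complex" where
  "phase z x t = \<i> * (z * of_real x + 2 * z\<^sup>2 * of_real t)"

lemma phase_eq:
  assumes "t \<noteq> 0"
  shows "phase z x t = of_real t * (\<i> * (z * of_real x / of_real t + 2 * z\<^sup>2))"
  using assms by (simp add: phase_def field_simps)

definition modified ::
  "(complex \<Rightarrow> real \<Rightarrow> real \<Rightarrow> complex^2^2) \<Rightarrow> complex \<Rightarrow> real \<Rightarrow> real \<Rightarrow> complex^2^2" where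
  "modified \<phi> z x t = \<phi> z x t ** exp_sigma3 (phase z x t)"

text \<open>
  Column \<open>j\<close> of a Jost solution, for \<open>z\<close> in the closed half plane \<open>D\<close> where it exists;
  \<open>F\<close> is \<^const>\<open>at_top\<close> or \<^const>\<open>at_bot\<close>.
\<close>

definition jost_column ::
  "real \<Rightarrow> real set \<Rightarrow> (real \<Rightarrow> real \<Rightarrow> complex) \<Rightarrow> (complex \<Rightarrow> real \<Rightarrow> real \<Rightarrow> complex^2^2) \<Rightarrow>
   2 \<Rightarrow> real filter \<Rightarrow> complex set \<Rightarrow> bool" where
  "jost_column \<sigma> J q \<phi> j F D \<longleftrightarrow>
     (\<forall>z\<in>D. lax_pair_solution \<sigma> J q z (\<lambda>x t. column j (\<phi> z x t)) \<and>
        (\<forall>t\<in>J. ((\<lambda>x. column j (modified \<phi> z x t)) \<longlongrightarrow> axis j 1) F))"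

definition jost_solutions ::
  "real \<Rightarrow> real set \<Rightarrow> (real \<Rightarrow> real \<Rightarrow> complex) \<Rightarrow> (complex \<Rightarrow> real \<Rightarrow> real \<Rightarrow> complex^2^2) \<Rightarrow>
   (complex \<Rightarrow> real \<Rightarrow> real \<Rightarrow> complex^2^2) \<Rightarrow> bool" where
  "jost_solutions \<sigma> J q \<phi>m \<phi>p \<longleftrightarrow>
     jost_column \<sigma> J q \<phi>m 1 at_bot {z. Im z \<ge> 0} \<and>
     jost_column \<sigma> J q \<phi>m 2 at_bot {z. Im z \<le> 0} \<and>
     jost_column \<sigma> J q \<phi>p 1 at_top {z. Im z \<le> 0} \<and>
     jost_column \<sigma> J q \<phi>p 2 at_top {z. Im z \<ge> 0}"


section \<open>Scattering data\<close>

text \<open>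
  \<open>ab\<close>, \<open>bb\<close> stand for the breve versions of \<open>a\<close> and \<open>b\<close>.
\<close>

definition scattering_data ::
  "real set \<Rightarrow> (complex \<Rightarrow> real \<Rightarrow> real \<Rightarrow> complex^2^2) \<Rightarrow> (complex \<Rightarrow> real \<Rightarrow> real \<Rightarrow> complex^2^2) \<Rightarrow>
   (complex \<Rightarrow> complex) \<Rightarrow> (complex \<Rightarrow> complex) \<Rightarrow> (real \<Rightarrow> complex) \<Rightarrow> (real \<Rightarrow> complex) \<Rightarrow> bool" where
  "scattering_data J \<phi>m \<phi>p a ab b bb \<longleftrightarrow>
     (\<forall>s::real. \<forall>x. \<forall>t\<in>J. \<phi>m (of_real s) x t =
        \<phi>p (of_real s) x t ** mat2 (a (of_real s)) (bb s) (b s) (ab (of_real s))) \<and>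
     (\<forall>z. Im z \<ge> 0 \<longrightarrow> (\<forall>x. \<forall>t\<in>J.
        a z = det (of_cols (column 1 (modified \<phi>m z x t)) (column 2 (modified \<phi>p z x t))))) \<and>
     (\<forall>z. Im z \<le> 0 \<longrightarrow> (\<forall>x. \<forall>t\<in>J.
        ab z = det (of_cols (column 1 (modified \<phi>p z x t)) (column 2 (modified \<phi>m z x t)))))"

text \<open>
  Genericity: the reflection coefficients \<open>b / a\<close> and \<open>bb / ab\<close> have no singular point on the
  real line.  Since \<open>a ab - b bb = 1\<close> there, a zero of a denominator is never compensated by
  the numerator, so the singular points are exactly the real zeros of \<open>a\<close> and \<open>ab\<close>.
\<close>

definition generic :: "(complex \<Rightarrow> complex) \<Rightarrow> (complex \<Rightarrow> complex) \<Rightarrow> bool" where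
  "generic a ab \<longleftrightarrow> (\<forall>s::real. a (of_real s) \<noteq> 0 \<and> ab (of_real s) \<noteq> 0)"

definition reflection :: "(complex \<Rightarrow> complex) \<Rightarrow> (real \<Rightarrow> complex) \<Rightarrow> real \<Rightarrow> complex" where
  "reflection a b s = b s / a (of_real s)"


section \<open>The Riemann-Hilbert problem\<close>

text \<open>Only the values off the real line are meaningful.\<close>

definition RH_matrix ::
  "(complex \<Rightarrow> real \<Rightarrow> real \<Rightarrow> complex^2^2) \<Rightarrow> (complex \<Rightarrow> real \<Rightarrow> real \<Rightarrow> complex^2^2) \<Rightarrow>
   (complex \<Rightarrow> complex) \<Rightarrow> (complex \<Rightarrow> complex) \<Rightarrow> complex \<Rightarrow> real \<Rightarrow> real \<Rightarrow> complex^2^2" where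
  "RH_matrix \<phi>m \<phi>p a ab z x t =
     (if Im z > 0
      then of_cols ((1 / a z) *s column 1 (modified \<phi>m z x t)) (column 2 (modified \<phi>p z x t))
      else of_cols (column 1 (modified \<phi>p z x t)) ((1 / ab z) *s column 2 (modified \<phi>m z x t)))"

text \<open>
  Sign convention: from \<open>\<phi>m = \<phi>p S\<close> and \<open>modified \<phi> = \<phi> exp_sigma3 phase\<close> one gets
  \<open>modified \<phi>m = modified \<phi>p (exp_hat_sigma3 (- phase) S)\<close>, whose lower left entry is
  \<open>b exp (2 phase)\<close>.  Hence the exponent in the jump matrix is \<open>- phase\<close>; with \<open>+ phase\<close>
  the jump relation is inconsistent with these normalizations unless both reflection
  coefficients vanish.
\<close>

definition jump_matrix ::
  "(real \<Rightarrow> complex) \<Rightarrow> (real \<Rightarrow> complex) \<Rightarrow> real \<Rightarrow> real \<Rightarrow> real \<Rightarrow> complex^2^2" where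
  "jump_matrix r rb s x t =
     exp_hat_sigma3 (- phase (of_real s) x t) (mat2 (1 - r s * rb s) (- rb s) (r s) 1)"

text \<open>
  Normalization: \<open>M\<close> tends to \<open>I\<close> as \<open>z\<close> tends to infinity without restriction in the complement
  of the real line, and the rate \<open>O(1/z)\<close> holds at any fixed distance from the line (in
  particular in every sector away from it).  For potentials that are merely in \<^const>\<open>H11\<close> the
  rate cannot be uniform up to the line: on it, \<open>M - I\<close> decays like the Fourier transform of a
  function in this space, in general not like \<open>1/z\<close>.
\<close>

definition solves_RHP :: "(real \<Rightarrow> complex^2^2) \<Rightarrow> (complex \<Rightarrow> complex^2^2) \<Rightarrow> bool" where
  "solves_RHP V M \<longleftrightarrow>
     (\<forall>i j. (\<lambda>z. M z $ i $ j) holomorphic_on {z. Im z \<noteq> 0}) \<and>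
     (M \<longlongrightarrow> mat 1) (inf at_infinity (principal {z. Im z \<noteq> 0})) \<and>
     (\<forall>\<delta>>0. (\<lambda>z. norm (M z - mat 1)) \<in>
        O[inf at_infinity (principal {z. \<bar>Im z\<bar> \<ge> \<delta>})](\<lambda>z. norm (1 / z))) \<and>
     (\<exists>Mp Mm. \<forall>s::real.
        (M \<longlongrightarrow> Mp s) (at (of_real s) within {z. Im z > 0}) \<and>
        (M \<longlongrightarrow> Mm s) (at (of_real s) within {z. Im z < 0}) \<and>
        Mp s = Mm s ** V s)"

end

theory Submission
  imports Defs
begin

text \<open>
  Everything happens at one fixed time, where only the \<open>x\<close>-equation of the Lax pair matters.
  Multiplying out the oscillating exponential, each of the four Jost columns becomes, after the
  substitutions \<open>x \<mapsto> - x\<close> (for the columns normalized at \<open>+\<infinity>\<close>) and \<open>z \<mapsto> - z\<close> (for those living in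
  the lower half plane) and possibly a swap of the two entries, a solution of the single system
  \<open>f' = q g\<close>, \<open>g' = p f + 2 i z g\<close> with \<open>(f, g) \<rightarrow> (1, 0)\<close> at \<open>-\<infinity>\<close> and \<open>Im z \<ge> 0\<close>
  (\<open>half_plane_normalized_columns\<close>).

  For \<open>Im z \<ge> 0\<close> the term \<open>2 i z g\<close> does not amplify, so Gronwall's inequality gives a stability estimate
  for the inhomogeneous system that is uniform in \<open>z\<close>, because \<open>q\<close> and \<open>p\<close> are integrable
  (\<open>stability\<close>).  All regularity in \<open>z\<close> follows from it, with no iteration scheme:
  the difference of two solutions, and the difference of two difference quotients, solve the same
  system with a small inhomogeneity.  The former gives continuity up to the real line, the
  latter shows that the difference quotients are Cauchy, hence that the solution is holomorphic for
  \<open>Im z > 0\<close> (\<open>continuous_jost_spectral\<close>, \<open>holomorphic_jost\<close>).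

  The behaviour at \<open>z = \<infinity>\<close> comes from integrating the fast exponential by parts, that is, from the equation
  satisfied by \<open>g + s f / (2 i z)\<close>, where \<open>s\<close> is the average of \<open>p\<close> over an interval of length
  \<open>1 / \<bar>z\<bar>\<^sup>2\<close>.  Averaging avoids differentiating \<open>p\<close>, which is only weakly differentiable, and the length is chosen so that
  both \<open>p - s\<close> and the remaining terms are of order \<open>1 / z\<close> (\<open>steklov_average\<close>, \<open>g_decay\<close>).

  Being holomorphic in the open and continuous in the closed half plane, with a limit at infinity that is
  attained at rate \<open>1 / z\<close> away from the line, is preserved by products, differences and by the reciprocal of
  the nowhere vanishing coefficient \<open>a\<close> (\<open>half_plane_normalized\<close>).  So all entries of the
  matrix have these properties, and the jump condition reduces to the algebraic identity
  \<open>jump_relation\<close> that rewrites \<open>\<phi>m = \<phi>p S\<close>.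
\<close>

section \<open>Linear differential inequalities on the line\<close>

lemma global_antiderivative:
  fixes f :: "real \<Rightarrow> 'a::euclidean_space"
  assumes "continuous_on UNIV f"
  obtains F where "\<And>x. (F has_vector_derivative f x) (at x)"
proof -
  have "\<exists>F. \<forall>x::real. - \<infinity> < ereal x \<longrightarrow> ereal x < \<infinity> \<longrightarrow> (F has_vector_derivative f x) (at x)"
    using assms by (intro einterval_antiderivative) (auto simp: continuous_on_eq_continuous_at)
  then show ?thesis using that by auto
qed

lemma integral_derivative:
  fixes F :: "real \<Rightarrow> real"
  assumes "\<And>x. (F has_real_derivative f x) (at x)" "a \<le> b"
  shows "(f has_integral (F b - F a)) {a..b}"
  using assms
  by (intro fundamental_theorem_of_calculus)
     (auto simp: has_real_derivative_iff_has_vector_derivative intro: has_vector_derivative_at_within)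

text \<open>
  The right-hand side of the hypothesis, multiplied by \<open>exp (- A)\<close>, is nonincreasing.
\<close>

lemma gronwall_integral:
  fixes u \<alpha> A :: "real \<Rightarrow> real"
  assumes ab: "a \<le> b" and u: "continuous_on {a..b} u" and \<alpha>: "continuous_on {a..b} \<alpha>"
    and pos: "\<And>y. 0 \<le> \<alpha> y"
    and A: "\<And>y. (A has_real_derivative \<alpha> y) (at y)"
    and le: "\<And>y. y \<in> {a..b} \<Longrightarrow> u y \<le> c + integral {a..y} (\<lambda>s. \<alpha> s * u s)"
  shows "u b \<le> c * exp (A b - A a)"
proof -
  define U where "U y = c + integral {a..y} (\<lambda>s. \<alpha> s * u s)" for y
  have dU: "(U has_real_derivative \<alpha> y * u y) (at y within {a..b})" if "y \<in> {a..b}" for y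
    unfolding U_def using that
    by (auto intro!: derivative_eq_intros integral_has_real_derivative continuous_intros u \<alpha>)
  have dV: "((\<lambda>y. U y * exp (- A y)) has_real_derivative
      (\<alpha> y * u y * exp (- A y) + exp (- A y) * (- \<alpha> y) * U y)) (at y within {a..b})"
    if "y \<in> {a..b}" for y
    by (rule derivative_eq_intros dU has_field_derivative_at_within[OF A] that refl)+
  have "U b * exp (- A b) \<le> U a * exp (- A a)"
  proof (rule DERIV_nonpos_imp_decreasing_open[OF ab])
    fix y assume y: "a < y" "y < b"
    have "at y within {a..b} = at y" using y by (simp add: at_within_Icc_at)
    with dV[of y] y have "((\<lambda>y. U y * exp (- A y)) has_real_derivative
        (\<alpha> y * u y * exp (- A y) + exp (- A y) * (- \<alpha> y) * U y)) (at y)" by auto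
    moreover have "\<alpha> y * exp (- A y) * (u y - U y) \<le> 0"
      using le[of y] y pos[of y] by (intro mult_nonneg_nonpos) (auto simp: U_def)
    then have "\<alpha> y * u y * exp (- A y) + exp (- A y) * (- \<alpha> y) * U y \<le> 0"
      by (simp add: algebra_simps)
    ultimately show "\<exists>D. ((\<lambda>y. U y * exp (- A y)) has_real_derivative D) (at y) \<and> D \<le> 0"
      by blast
  next
    show "continuous_on {a..b} (\<lambda>y. U y * exp (- A y))"
      using dV by (rule DERIV_continuous_on)
  qed
  then have "U b \<le> U a * exp (A b - A a)"
    by (simp add: exp_diff exp_minus field_simps)
  moreover have "u b \<le> U b" using le[of b] ab by (simp add: U_def)
  ultimately show ?thesis by (simp add: U_def)
qed

text \<open>
  Variation of constants.  The weight inside the integral is kept because for \<open>Im z > 0\<close> it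
  makes bounded inhomogeneities harmless on arbitrarily long intervals; the initial value carries the weight
  \<open>exp (- 2 Im z (b - a))\<close>, which is at most \<open>1\<close>.
\<close>

lemma damped_linear_ode_bound:
  fixes n g :: "real \<Rightarrow> complex"
  assumes ab: "a \<le> b" and z: "0 \<le> Im z"
    and n: "\<And>y. (n has_vector_derivative (2 * \<i> * z * n y + g y)) (at y)"
    and g: "continuous_on UNIV g"
  shows "norm (n b) \<le> norm (n a) + integral {a..b} (\<lambda>y. exp (- 2 * Im z * (b - y)) * norm (g y))"
proof -
  define E where "E y = exp (2 * \<i> * z * of_real (b - y))" for y
  have dE: "(E has_vector_derivative (- 2 * \<i> * z * E y)) (at y)" for y
    unfolding E_def
    by (rule derivative_eq_intros has_vector_derivative_real_field | simp)+
  have d: "((\<lambda>y. E y * n y) has_vector_derivative (E y * g y)) (at y)" for y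
    by (rule has_vector_derivative_eq_rhs[OF has_vector_derivative_mult[OF dE n]]) (simp add: algebra_simps)
  have nE: "norm (E y) = exp (- 2 * Im z * (b - y))" for y
    by (simp add: E_def)
  have contE: "continuous_on S E" for S
    unfolding E_def by (intro continuous_intros)
  have I: "((\<lambda>y. E y * g y) has_integral (E b * n b - E a * n a)) {a..b}"
    using ab d by (intro fundamental_theorem_of_calculus) (auto intro: has_vector_derivative_at_within)
  have "norm (integral {a..b} (\<lambda>y. E y * g y)) \<le> integral {a..b} (\<lambda>y. exp (- 2 * Im z * (b - y)) * norm (g y))"
    using g by (intro integral_norm_bound_integral integrable_continuous_real continuous_intros contE)
       (auto simp: norm_mult nE intro: continuous_on_subset)
  moreover have "integral {a..b} (\<lambda>y. E y * g y) = n b - E a * n a"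
    using I by (simp add: integral_unique E_def)
  moreover have "norm (E a * n a) \<le> norm (n a)"
    using ab z by (simp add: norm_mult nE mult_left_le_one_le)
  ultimately show ?thesis
    by (smt (verit) norm_triangle_sub)
qed

lemma damping_factor_integral:
  fixes a b \<delta> :: real
  assumes "a \<le> b"
  shows "0 \<le> \<delta> \<Longrightarrow> integral {a..b} (\<lambda>y. exp (- 2 * \<delta> * (b - y))) \<le> b - a"
    and "0 < \<delta> \<Longrightarrow> integral {a..b} (\<lambda>y. exp (- 2 * \<delta> * (b - y))) \<le> 1 / (2 * \<delta>)"
proof -
  assume "0 \<le> \<delta>"
  then have "integral {a..b} (\<lambda>y. exp (- 2 * \<delta> * (b - y))) \<le> integral {a..b} (\<lambda>y. 1)"
    by (intro integral_le integrable_continuous_real continuous_intros) auto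
  then show "integral {a..b} (\<lambda>y. exp (- 2 * \<delta> * (b - y))) \<le> b - a"
    using assms by simp
next
  assume \<delta>: "0 < \<delta>"
  have "((\<lambda>y. exp (- 2 * \<delta> * (b - y)) / (2 * \<delta>)) has_real_derivative exp (- 2 * \<delta> * (b - y))) (at y)" for y
    using \<delta> by (auto intro!: derivative_eq_intros)
  note I = integral_unique[OF integral_derivative[OF this assms]]
  show "integral {a..b} (\<lambda>y. exp (- 2 * \<delta> * (b - y))) \<le> 1 / (2 * \<delta>)"
    unfolding I using \<delta> by simp
qed

section \<open>The Jost system in the upper half plane\<close>

lemma le_limit_at_bot:
  fixes c x :: real
  assumes "(h \<longlongrightarrow> l) at_bot" "\<And>a. a \<le> x \<Longrightarrow> c \<le> h a"
  shows "c \<le> l"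
  using assms(1)
proof (rule tendsto_lowerbound)
  show "\<forall>\<^sub>F a in at_bot. c \<le> h a"
    unfolding eventually_at_bot_linorder using assms(2) by blast
qed (rule trivial_limit_at_bot_linorder)

text \<open>
  The primitive \<open>A\<close> of \<open>\<bar>q\<bar> + \<bar>p\<bar>\<close> vanishing at \<open>-\<infinity>\<close> encodes integrability of the potentials:
  \<open>A x\<close> is the mass to the left of \<open>x\<close>, and \<open>L\<close> bounds the total mass.
\<close>

locale potential_pair =
  fixes q p :: "real \<Rightarrow> complex" and A :: "real \<Rightarrow> real" and L :: real
  assumes continuous_q: "continuous_on UNIV q" and continuous_p: "continuous_on UNIV p"
    and A_deriv: "\<And>x. (A has_real_derivative norm (q x) + norm (p x)) (at x)"
    and A_at_bot: "(A \<longlongrightarrow> 0) at_bot" and A_le: "\<And>x. A x \<le> L"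
begin

lemma A_mono: "x \<le> y \<Longrightarrow> A x \<le> A y"
  by (rule DERIV_nonneg_imp_nondecreasing) (use A_deriv in \<open>auto intro!: exI add_nonneg_nonneg\<close>)

lemma A_nonneg: "0 \<le> A x"
  using A_at_bot
  by (rule tendsto_upperbound) (auto intro: A_mono simp: eventually_at_bot_linorder)

lemma A_diff_le: "A x - A y \<le> L"
  using A_le[of x] A_nonneg[of y] by linarith

lemma L_nonneg: "0 \<le> L"
  using A_le[of 0] A_nonneg[of 0] by linarith

lemma integral_potentials:
  assumes "a \<le> b"
  shows "integral {a..b} (\<lambda>y. norm (q y)) \<le> A b - A a"
    and "integral {a..b} (\<lambda>y. norm (p y)) \<le> A b - A a"
proof -
  have I: "integral {a..b} (\<lambda>y. norm (q y) + norm (p y)) = A b - A a"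
    using integral_derivative[OF A_deriv assms] by (rule integral_unique)
  show "integral {a..b} (\<lambda>y. norm (q y)) \<le> A b - A a"
    "integral {a..b} (\<lambda>y. norm (p y)) \<le> A b - A a"
    unfolding I[symmetric]
    by (intro integral_le integrable_continuous_real continuous_intros
          continuous_on_subset[OF continuous_q] continuous_on_subset[OF continuous_p]; simp)+
qed

text \<open>
  The basic estimate.  Both components are bounded by \<open>damped_linear_ode_bound\<close> (the first with
  spectral parameter \<open>0\<close>), their sum by Gronwall's inequality.  The inhomogeneity \<open>h\<close> enters through its
  damped integral \<open>K\<close>, so that it may be controlled either in the integral norm or, when \<open>Im z > 0\<close>, in
  the supremum norm.
\<close>

lemma stability:
  assumes ab: "a \<le> b" and z: "0 \<le> Im z"
    and d1: "\<And>y. (d1 has_vector_derivative q y * d2 y) (at y)"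
    and d2: "\<And>y. (d2 has_vector_derivative p y * d1 y + 2 * \<i> * z * d2 y + h y) (at y)"
    and h: "continuous_on UNIV h"
    and K: "\<And>y. y \<in> {a..b} \<Longrightarrow> integral {a..y} (\<lambda>s. exp (- 2 * Im z * (y - s)) * norm (h s)) \<le> K"
  shows "norm (d1 b) + norm (d2 b) \<le> (norm (d1 a) + norm (d2 a) + K) * exp L"
proof -
  have cd: "continuous_on S d1" "continuous_on S d2" for S
    using d1 d2 by (meson continuous_at_imp_continuous_on has_vector_derivative_continuous)+
  have c: "continuous_on S q" "continuous_on S p" "continuous_on S h" for S
    using continuous_q continuous_p h by (auto intro: continuous_on_subset)
  note ci = integrable_continuous_real continuous_intros cd c
  have K0: "0 \<le> K" using K[of a] ab by simp
  have "norm (d1 b) + norm (d2 b) \<le> (norm (d1 a) + norm (d2 a) + K) * exp (A b - A a)"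
  proof (rule gronwall_integral[where \<alpha> = "\<lambda>y. norm (q y) + norm (p y)" and u = "\<lambda>y. norm (d1 y) + norm (d2 y)"])
    fix y assume y: "y \<in> {a..b}"
    then have ay: "a \<le> y" by simp
    have "norm (d1 y) \<le> norm (d1 a) + integral {a..y} (\<lambda>s. exp (- 2 * Im 0 * (y - s)) * norm (q s * d2 s))"
      by (rule damped_linear_ode_bound[OF ay]) (use d1 in \<open>auto intro!: ci\<close>)
    then have 1: "norm (d1 y) \<le> norm (d1 a) + integral {a..y} (\<lambda>s. norm (q s) * norm (d2 s))"
      by (simp add: norm_mult)
    have "norm (d2 y) \<le> norm (d2 a) + integral {a..y} (\<lambda>s. exp (- 2 * Im z * (y - s)) * norm (p s * d1 s + h s))"
      by (rule damped_linear_ode_bound[OF ay z]) (use d2 in \<open>auto intro!: ci simp: algebra_simps\<close>)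
    also have "integral {a..y} (\<lambda>s. exp (- 2 * Im z * (y - s)) * norm (p s * d1 s + h s))
        \<le> integral {a..y} (\<lambda>s. norm (p s) * norm (d1 s) + exp (- 2 * Im z * (y - s)) * norm (h s))"
    proof (intro integral_le ci)
      fix s assume s: "s \<in> {a..y}"
      let ?e = "exp (- 2 * Im z * (y - s))"
      have e: "?e \<le> 1" using s z by simp
      have "?e * norm (p s * d1 s + h s) \<le> ?e * (norm (p s) * norm (d1 s) + norm (h s))"
        by (intro mult_left_mono order_trans[OF norm_triangle_ineq]) (auto simp: norm_mult)
      also have "\<dots> \<le> norm (p s) * norm (d1 s) + ?e * norm (h s)"
        using mult_right_mono[OF e, of "norm (p s) * norm (d1 s)"] by (simp add: algebra_simps)
      finally show "?e * norm (p s * d1 s + h s) \<le> norm (p s) * norm (d1 s) + ?e * norm (h s)" .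
    qed
    also have "\<dots> = integral {a..y} (\<lambda>s. norm (p s) * norm (d1 s))
        + integral {a..y} (\<lambda>s. exp (- 2 * Im z * (y - s)) * norm (h s))"
      by (intro integral_add ci)
    finally have 2: "norm (d2 y) \<le> norm (d2 a) + integral {a..y} (\<lambda>s. norm (p s) * norm (d1 s)) + K"
      using K[OF y] by simp
    have "integral {a..y} (\<lambda>s. norm (q s) * norm (d2 s)) + integral {a..y} (\<lambda>s. norm (p s) * norm (d1 s))
        = integral {a..y} (\<lambda>s. norm (q s) * norm (d2 s) + norm (p s) * norm (d1 s))"
      by (intro integral_add[symmetric] ci)
    also have "\<dots> \<le> integral {a..y} (\<lambda>s. (norm (q s) + norm (p s)) * (norm (d1 s) + norm (d2 s)))"
      by (intro integral_le ci) (auto simp: algebra_simps)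
    finally show "norm (d1 y) + norm (d2 y) \<le> norm (d1 a) + norm (d2 a) + K
        + integral {a..y} (\<lambda>s. (norm (q s) + norm (p s)) * (norm (d1 s) + norm (d2 s)))"
      using 1 2 by linarith
  qed (auto intro!: ci ab A_deriv)
  also have "\<dots> \<le> (norm (d1 a) + norm (d2 a) + K) * exp L"
    using A_diff_le K0 by (intro mult_left_mono) auto
  finally show ?thesis .
qed

lemma stability_at_bot:
  assumes z: "0 < Im z"
    and d1: "\<And>y. (d1 has_vector_derivative q y * d2 y) (at y)"
    and d2: "\<And>y. (d2 has_vector_derivative p y * d1 y + 2 * \<i> * z * d2 y + h y) (at y)"
    and h: "continuous_on UNIV h" and S: "\<And>y. norm (h y) \<le> S"
    and lim: "(d1 \<longlongrightarrow> 0) at_bot" "(d2 \<longlongrightarrow> 0) at_bot"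
  shows "norm (d1 x) + norm (d2 x) \<le> S / (2 * Im z) * exp L"
proof -
  have S0: "0 \<le> S" using S[of 0] norm_ge_zero order_trans by blast
  have "((\<lambda>a. (norm (d1 a) + norm (d2 a) + S / (2 * Im z)) * exp L)
      \<longlongrightarrow> (norm (0::complex) + norm (0::complex) + S / (2 * Im z)) * exp L) at_bot"
    by (intro tendsto_intros lim)
  moreover have "norm (d1 x) + norm (d2 x) \<le> (norm (d1 a) + norm (d2 a) + S / (2 * Im z)) * exp L"
    if "a \<le> x" for a
  proof (rule stability[OF that _ d1 d2 h])
    fix y assume y: "y \<in> {a..x}"
    have "integral {a..y} (\<lambda>s. exp (- 2 * Im z * (y - s)) * norm (h s))
        \<le> integral {a..y} (\<lambda>s. exp (- 2 * Im z * (y - s)) * S)"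
      using S continuous_on_subset[OF h]
      by (intro integral_le integrable_continuous_real continuous_intros mult_left_mono) auto
    also have "\<dots> = integral {a..y} (\<lambda>s. exp (- 2 * Im z * (y - s))) * S"
      by (rule integral_mult_left)
    also have "\<dots> \<le> 1 / (2 * Im z) * S"
      using y z S0 by (intro mult_right_mono damping_factor_integral) auto
    finally show "integral {a..y} (\<lambda>s. exp (- 2 * Im z * (y - s)) * norm (h s)) \<le> S / (2 * Im z)"
      by simp
  qed (use z in simp)
  ultimately show ?thesis
    using le_limit_at_bot by fastforce
qed

end

text \<open>
  The two limits at \<open>-\<infinity>\<close> determine the solution for each \<open>z\<close> separately; this uniqueness, in its
  quantitative form \<open>stability\<close>, is the source of all regularity in \<open>z\<close>.
\<close>

locale jost_normal_form = potential_pair +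
  fixes f g :: "complex \<Rightarrow> real \<Rightarrow> complex"
  assumes f_deriv: "\<And>z x. 0 \<le> Im z \<Longrightarrow> (f z has_vector_derivative q x * g z x) (at x)"
    and g_deriv: "\<And>z x. 0 \<le> Im z \<Longrightarrow>
          (g z has_vector_derivative p x * f z x + 2 * \<i> * z * g z x) (at x)"
    and f_at_bot: "\<And>z. 0 \<le> Im z \<Longrightarrow> (f z \<longlongrightarrow> 1) at_bot"
    and g_at_bot: "\<And>z. 0 \<le> Im z \<Longrightarrow> (g z \<longlongrightarrow> 0) at_bot"
begin

lemma continuous_jost:
  assumes "0 \<le> Im z"
  shows "continuous_on S (f z)" "continuous_on S (g z)"
  using f_deriv[OF assms] g_deriv[OF assms]
  by (meson continuous_at_imp_continuous_on has_vector_derivative_continuous)+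

lemma jost_bound:
  assumes z: "0 \<le> Im z"
  shows "norm (f z x) + norm (g z x) \<le> exp L"
proof -
  have "((\<lambda>a. (norm (f z a) + norm (g z a) + 0) * exp L)
      \<longlongrightarrow> (norm (1::complex) + norm (0::complex) + 0) * exp L) at_bot"
    by (intro tendsto_intros f_at_bot g_at_bot z)
  moreover have "norm (f z x) + norm (g z x) \<le> (norm (f z a) + norm (g z a) + 0) * exp L"
    if "a \<le> x" for a
    using f_deriv[OF z] g_deriv[OF z]
    by (intro stability[OF that z, where h = "\<lambda>_. 0"]) auto
  ultimately show ?thesis
    using le_limit_at_bot by fastforce
qed

text \<open>
  The pair \<open>(f - 1, g)\<close> solves the system with inhomogeneity \<open>p\<close>.  The bound is independent of \<open>z\<close>, which is
  what allows limits in \<open>z\<close> to be taken after cutting off a left half line.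
\<close>

lemma jost_tail:
  assumes z: "0 \<le> Im z"
  shows "norm (f z x - 1) + norm (g z x) \<le> A x * exp L"
proof -
  have "((\<lambda>a. (norm (f z a - 1) + norm (g z a) + A x) * exp L)
      \<longlongrightarrow> (norm (1 - 1::complex) + norm (0::complex) + A x) * exp L) at_bot"
    by (intro tendsto_intros f_at_bot g_at_bot z)
  moreover have "norm (f z x - 1) + norm (g z x) \<le> (norm (f z a - 1) + norm (g z a) + A x) * exp L"
    if "a \<le> x" for a
  proof (rule stability[OF that z, where h = p])
    fix y assume y: "y \<in> {a..x}"
    have "integral {a..y} (\<lambda>s. exp (- 2 * Im z * (y - s)) * norm (p s)) \<le> integral {a..y} (\<lambda>s. norm (p s))"
      using z by (intro integral_le integrable_continuous_real continuous_intros
                 continuous_on_subset[OF continuous_p]) (auto simp: mult_left_le_one_le)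
    also have "\<dots> \<le> A y - A a" using y by (intro integral_potentials) auto
    also have "\<dots> \<le> A x" using A_mono[of y x] A_nonneg[of a] y by simp
    finally show "integral {a..y} (\<lambda>s. exp (- 2 * Im z * (y - s)) * norm (p s)) \<le> A x" .
  next
    fix y
    show "((\<lambda>y. f z y - 1) has_vector_derivative q y * g z y) (at y)"
      by (rule has_vector_derivative_eq_rhs[OF has_vector_derivative_diff[OF f_deriv[OF z] has_vector_derivative_const]]) simp
    show "(g z has_vector_derivative p y * (f z y - 1) + 2 * \<i> * z * g z y + p y) (at y)"
      by (rule has_vector_derivative_eq_rhs[OF g_deriv[OF z]]) (simp add: algebra_simps)
  qed (rule continuous_p)
  ultimately show ?thesis
    using le_limit_at_bot by fastforce
qed

lemma jost_difference:
  assumes z: "0 \<le> Im z" and w: "0 \<le> Im w"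
  shows "((\<lambda>y. f z y - f w y) has_vector_derivative q y * (g z y - g w y)) (at y)"
    and "((\<lambda>y. g z y - g w y) has_vector_derivative
           p y * (f z y - f w y) + 2 * \<i> * z * (g z y - g w y) + 2 * \<i> * (z - w) * g w y) (at y)"
  by (rule has_vector_derivative_eq_rhs[OF has_vector_derivative_diff[OF f_deriv[OF z] f_deriv[OF w]]]
           has_vector_derivative_eq_rhs[OF has_vector_derivative_diff[OF g_deriv[OF z] g_deriv[OF w]]];
      simp add: algebra_simps)+

lemma norm_g_le: "0 \<le> Im z \<Longrightarrow> norm (g z x) \<le> exp L"
  using jost_bound[of z x] norm_ge_zero[of "f z x"] by linarith

lemma norm_f_le: "0 \<le> Im z \<Longrightarrow> norm (f z x) \<le> exp L"
  using jost_bound[of z x] norm_ge_zero[of "g z x"] by linarith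

text \<open>
  For real spectral parameters \<open>g\<close> need not be integrable at \<open>-\<infinity>\<close>, so the comparison of two parameters
  starts at a finite point \<open>a\<close>, where both solutions are close to \<open>(1, 0)\<close>.
\<close>

lemma jost_perturbation:
  assumes z: "0 \<le> Im z" and w: "0 \<le> Im w" and ax: "a \<le> x"
  shows "norm (f z x - f w x) + norm (g z x - g w x)
    \<le> (2 * A a * exp L + (x - a) * (2 * norm (z - w) * exp L)) * exp L"
proof -
  have "norm (f z x - f w x) + norm (g z x - g w x)
    \<le> (norm (f z a - f w a) + norm (g z a - g w a) + (x - a) * (2 * norm (z - w) * exp L)) * exp L"
  proof (rule stability[OF ax z jost_difference[OF z w]])
    fix y assume y: "y \<in> {a..x}"
    have "integral {a..y} (\<lambda>s. exp (- 2 * Im z * (y - s)) * norm (2 * \<i> * (z - w) * g w s))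
        \<le> integral {a..y} (\<lambda>s. 2 * norm (z - w) * exp L)"
    proof (intro integral_le integrable_continuous_real continuous_intros continuous_jost w)
      fix s assume s: "s \<in> {a..y}"
      have "exp (- 2 * Im z * (y - s)) * norm (2 * \<i> * (z - w) * g w s) \<le> 1 * (2 * norm (z - w) * exp L)"
        using s z by (intro mult_mono) (auto simp: norm_mult norm_g_le w intro!: mult_left_mono)
      then show "exp (- 2 * Im z * (y - s)) * norm (2 * \<i> * (z - w) * g w s) \<le> 2 * norm (z - w) * exp L"
        by simp
    qed
    also have "\<dots> = (y - a) * (2 * norm (z - w) * exp L)"
      using y by simp
    also have "\<dots> \<le> (x - a) * (2 * norm (z - w) * exp L)"
      using y by (intro mult_right_mono) auto
    finally show "integral {a..y} (\<lambda>s. exp (- 2 * Im z * (y - s)) * norm (2 * \<i> * (z - w) * g w s))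
      \<le> (x - a) * (2 * norm (z - w) * exp L)" .
  qed (intro continuous_intros continuous_jost w)
  also have "\<dots> \<le> (2 * A a * exp L + (x - a) * (2 * norm (z - w) * exp L)) * exp L"
  proof (intro mult_right_mono add_right_mono)
    have "norm (f z a - f w a) \<le> norm (f z a - 1) + norm (f w a - 1)"
      by (metis dist_commute dist_norm dist_triangle)
    moreover have "norm (g z a - g w a) \<le> norm (g z a) + norm (g w a)"
      by (rule norm_triangle_ineq4)
    ultimately show "norm (f z a - f w a) + norm (g z a - g w a) \<le> 2 * A a * exp L"
      using jost_tail[OF z, of a] jost_tail[OF w, of a] by linarith
  qed simp
  finally show ?thesis .
qed

lemma continuous_jost_spectral:
  shows "continuous_on {z. 0 \<le> Im z} (\<lambda>z. f z x)" and "continuous_on {z. 0 \<le> Im z} (\<lambda>z. g z x)"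
proof -
  have key: "\<exists>d>0. \<forall>z\<in>{z. 0 \<le> Im z}. dist z w < d \<longrightarrow> norm (f z x - f w x) + norm (g z x - g w x) < e"
    if w: "0 \<le> Im w" and e: "0 < e" for w e
  proof -
    have "((\<lambda>a. 2 * A a * exp L * exp L) \<longlongrightarrow> 2 * 0 * exp L * exp L) at_bot"
      by (intro tendsto_intros A_at_bot)
    then have "\<forall>\<^sub>F a in at_bot. 2 * A a * exp L * exp L < e / 2"
      using e by (intro order_tendstoD) auto
    then have "\<forall>\<^sub>F a in at_bot. 2 * A a * exp L * exp L < e / 2 \<and> a < x"
      using eventually_gt_at_bot[of x] by (auto simp: eventually_conj_iff)
    then obtain a where a: "2 * A a * exp L * exp L < e / 2" "a < x"
      by (metis (mono_tags, lifting) eventually_happens trivial_limit_at_bot_linorder)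
    define C where "C = (x - a) * 2 * exp L * exp L"
    have C: "0 < C" using a by (simp add: C_def)
    show ?thesis
    proof (intro exI[of _ "e / (2 * C)"] conjI ballI impI)
      fix z assume z: "z \<in> {z. 0 \<le> Im z}" and d: "dist z w < e / (2 * C)"
      have "norm (f z x - f w x) + norm (g z x - g w x) \<le> 2 * A a * exp L * exp L + C * norm (z - w)"
        using jost_perturbation[of z w a x] z w a by (simp add: C_def algebra_simps)
      also have "C * norm (z - w) < e / 2"
        using d C by (simp add: dist_norm field_simps)
      finally show "norm (f z x - f w x) + norm (g z x - g w x) < e" using a by simp
    qed (use e C in simp)
  qed
  show "continuous_on {z. 0 \<le> Im z} (\<lambda>z. f z x)" "continuous_on {z. 0 \<le> Im z} (\<lambda>z. g z x)"
    unfolding continuous_on_iff dist_norm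
    using key by (smt (verit) norm_ge_zero mem_Collect_eq dist_norm)+
qed

lemma jost_lipschitz:
  assumes z: "0 < Im z" and w: "0 \<le> Im w"
  shows "norm (f z x - f w x) + norm (g z x - g w x) \<le> (exp L)\<^sup>2 / Im z * norm (z - w)"
proof -
  have z': "0 \<le> Im z" using z by simp
  have "norm (f z x - f w x) + norm (g z x - g w x) \<le> (2 * norm (z - w) * exp L) / (2 * Im z) * exp L"
  proof (rule stability_at_bot[OF z jost_difference[OF z' w]])
    show "((\<lambda>y. f z y - f w y) \<longlongrightarrow> 0) at_bot"
      using tendsto_diff[OF f_at_bot[OF z'] f_at_bot[OF w]] by simp
    show "((\<lambda>y. g z y - g w y) \<longlongrightarrow> 0) at_bot"
      using tendsto_diff[OF g_at_bot[OF z'] g_at_bot[OF w]] by simp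
    show "norm (2 * \<i> * (z - w) * g w y) \<le> 2 * norm (z - w) * exp L" for y
      by (auto simp: norm_mult norm_g_le w intro!: mult_left_mono)
  qed (intro continuous_intros continuous_jost w)
  then show ?thesis by (simp add: power2_eq_square algebra_simps)
qed

text \<open>
  The difference quotients \<open>F h\<close>, \<open>G h\<close> at \<open>z\<close> solve the system with inhomogeneity \<open>2 i g (z + h)\<close>.  By
  \<open>jost_lipschitz\<close> these inhomogeneities are Lipschitz in \<open>h\<close>, so by stability the quotients are
  Lipschitz in \<open>h\<close> as well and converge as \<open>h \<rightarrow> 0\<close> by completeness.
\<close>

lemma holomorphic_jost:
  shows "(\<lambda>z. f z x) holomorphic_on {z. 0 < Im z}" and "(\<lambda>z. g z x) holomorphic_on {z. 0 < Im z}"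
proof -
  have key: "(\<lambda>z. f z x) field_differentiable at z \<and> (\<lambda>z. g z x) field_differentiable at z"
    if z: "0 < Im z" for z
  proof -
    \<comment> \<open>The half leaves room to move \<open>z\<close> inside a disc on which the damping is at least \<open>\<delta>\<close>.\<close>
    define \<delta> where "\<delta> = Im z / 2"
    have \<delta>: "0 < \<delta>" using z by (simp add: \<delta>_def)
    define U where "U = ball 0 \<delta> - {0::complex}"
    have U: "\<delta> \<le> Im (z + h)" "h \<noteq> 0" if "h \<in> U" for h
      using that abs_Im_le_cmod[of h] by (auto simp: U_def \<delta>_def dist_norm)
    define F where "F h y = (f (z + h) y - f z y) / h" for h y
    define G where "G h y = (g (z + h) y - g z y) / h" for h y
    define C where "C = (2 * ((exp L)\<^sup>2 / \<delta>)) / (2 * Im z) * exp L"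
    have z': "0 \<le> Im z" using z by simp
    have lip: "norm (F h x - F k x) + norm (G h x - G k x) \<le> C * norm (h - k)"
      if h: "h \<in> U" and k: "k \<in> U" for h k
    proof -
      have h': "0 \<le> Im (z + h)" "0 < Im (z + h)" and k': "0 \<le> Im (z + k)"
        using U h k \<delta> by force+
      have dF: "(F h has_vector_derivative q y * G h y) (at y)" if "h \<in> U" for h y
        unfolding F_def G_def
        using U[OF that] \<delta> z
        by (intro has_vector_derivative_eq_rhs[OF has_vector_derivative_divide[OF jost_difference(1)]]) auto
      have dG: "(G h has_vector_derivative p y * F h y + 2 * \<i> * z * G h y + 2 * \<i> * g (z + h) y) (at y)"
        if "h \<in> U" for h y
        unfolding F_def G_def
        using U[OF that] \<delta> z
        by (intro has_vector_derivative_eq_rhs[OF has_vector_derivative_divide[OF jost_difference(2)]])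
           (auto simp: field_simps)
      have limF: "(F h \<longlongrightarrow> 0) at_bot" if "h \<in> U" for h
        using tendsto_divide[OF tendsto_diff[OF f_at_bot[of "z + h"] f_at_bot[of z]] tendsto_const[of h]] U[OF that] \<delta> z
        by (simp add: F_def[abs_def])
      have limG: "(G h \<longlongrightarrow> 0) at_bot" if "h \<in> U" for h
        using tendsto_divide[OF tendsto_diff[OF g_at_bot[of "z + h"] g_at_bot[of z]] tendsto_const[of h]] U[OF that] \<delta> z
        by (simp add: G_def[abs_def])
      have "norm (F h x - F k x) + norm (G h x - G k x) \<le> (2 * ((exp L)\<^sup>2 / \<delta> * norm (h - k))) / (2 * Im z) * exp L"
      proof (rule stability_at_bot[OF z, where h = "\<lambda>y. 2 * \<i> * (g (z + h) y - g (z + k) y)"])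
        show "((\<lambda>y. F h y - F k y) has_vector_derivative q y * (G h y - G k y)) (at y)" for y
          by (rule has_vector_derivative_eq_rhs[OF has_vector_derivative_diff[OF dF[OF h] dF[OF k]]])
             (simp add: algebra_simps)
        show "((\<lambda>y. G h y - G k y) has_vector_derivative
            p y * (F h y - F k y) + 2 * \<i> * z * (G h y - G k y) + 2 * \<i> * (g (z + h) y - g (z + k) y)) (at y)" for y
          by (rule has_vector_derivative_eq_rhs[OF has_vector_derivative_diff[OF dG[OF h] dG[OF k]]])
             (simp add: algebra_simps)
        show "norm (2 * \<i> * (g (z + h) y - g (z + k) y)) \<le> 2 * ((exp L)\<^sup>2 / \<delta> * norm (h - k))" for y
        proof -
          have "norm (g (z + h) y - g (z + k) y) \<le> (exp L)\<^sup>2 / Im (z + h) * norm ((z + h) - (z + k))"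
            by (smt (verit) jost_lipschitz[of "z + h" "z + k" y] h' k' norm_ge_zero)
          also have "\<dots> \<le> (exp L)\<^sup>2 / \<delta> * norm (h - k)"
            using U[OF h] \<delta> by (intro mult_mono divide_left_mono) auto
          finally show ?thesis by (simp add: norm_mult)
        qed
        show "((\<lambda>y. F h y - F k y) \<longlongrightarrow> 0) at_bot" "((\<lambda>y. G h y - G k y) \<longlongrightarrow> 0) at_bot"
          using tendsto_diff[OF limF[OF h] limF[OF k]] tendsto_diff[OF limG[OF h] limG[OF k]] by auto
      qed (intro continuous_intros continuous_jost h' k')
      then show ?thesis by (simp add: C_def algebra_simps)
    qed
    have C0: "0 \<le> C" using z \<delta> by (simp add: C_def)
    have ucont: "uniformly_continuous_on U (\<lambda>h. H h)"
      if "\<And>h k. h \<in> U \<Longrightarrow> k \<in> U \<Longrightarrow> norm (H h - H k) \<le> C * norm (h - k)" for H :: "complex \<Rightarrow> complex"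
      using that C0 by (intro lipschitz_on_uniformly_continuous[of C] lipschitz_onI) (auto simp: dist_norm)
    have "uniformly_continuous_on U (\<lambda>h. F h x)" "uniformly_continuous_on U (\<lambda>h. G h x)"
      using lip by (intro ucont; smt (verit) norm_ge_zero)+
    moreover have "0 \<in> closure U"
      using \<delta> islimpt_in_closure[of 0 "ball (0::complex) \<delta>"] by (auto simp: U_def islimpt_ball)
    ultimately obtain lF lG where "((\<lambda>h. F h x) \<longlongrightarrow> lF) (at 0 within U)" "((\<lambda>h. G h x) \<longlongrightarrow> lG) (at 0 within U)"
      using uniformly_continuous_on_extension_at_closure by metis
    moreover have "at 0 within U = at (0::complex)"
    proof -
      have "at 0 within U = at 0 within ball 0 \<delta>" by (simp add: U_def at_within_def)
      also have "\<dots> = at 0" using \<delta> by (intro at_within_open) auto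
      finally show ?thesis .
    qed
    ultimately show ?thesis
      unfolding field_differentiable_def DERIV_def F_def G_def by auto
  qed
  show "(\<lambda>z. f z x) holomorphic_on {z. 0 < Im z}" "(\<lambda>z. g z x) holomorphic_on {z. 0 < Im z}"
    using key by (auto simp: holomorphic_on_def field_differentiable_at_within)
qed

end

section \<open>Large spectral parameters\<close>

text \<open>
  The condition on increments is all that is needed from square integrability of \<open>p'\<close>: think of \<open>B\<close> as the
  primitive of \<open>\<bar>p'\<bar>\<^sup>2\<close>.  Keeping the weight \<open>c\<close> of the arithmetic-geometric inequality free
  makes the one condition usable at two different scales.
\<close>

locale regular_jost_normal_form = jost_normal_form +
  fixes B :: "real \<Rightarrow> real" and M P0 :: real
  assumes continuous_B: "continuous_on UNIV B" and mono_B: "mono B" and B_bound: "\<And>x. \<bar>B x\<bar> \<le> M"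
    and p_modulus: "\<And>x y c. x \<le> y \<Longrightarrow> 0 < c \<Longrightarrow>
          2 * norm (p y - p x) \<le> c * (y - x) + (B y - B x) / c"
    and p_bound: "\<And>x. norm (p x) \<le> P0"
begin

lemma M_nonneg: "0 \<le> M" and P0_nonneg: "0 \<le> P0"
  using B_bound[of 0] p_bound[of 0] by (linarith, metis norm_ge_zero order_trans)

text \<open>
  The average of \<open>p\<close> over \<open>[y, y + 1 / r\<^sup>2]\<close> is a smooth substitute for \<open>p\<close>: weight \<open>c = r\<close> in the
  increment condition gives the approximation error, weight \<open>c = 1\<close> the bound for the derivative.
\<close>

lemma steklov_average:
  assumes r: "0 < r"
  obtains s s' where "\<And>y. (s has_vector_derivative s' y) (at y)" "continuous_on UNIV s" "continuous_on UNIV s'"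
    "\<And>y. norm (s y) \<le> P0" "\<And>y. norm (p y - s y) \<le> (1 + 2 * M) / (2 * r)"
    "\<And>y. 2 * norm (s' y) \<le> 1 + r\<^sup>2 * (B (y + 1 / r\<^sup>2) - B y)"
proof -
  define h where "h = 1 / r\<^sup>2"
  have h: "0 < h" using r by (simp add: h_def)
  obtain P where P: "\<And>x. (P has_vector_derivative p x) (at x)"
    using global_antiderivative[OF continuous_p] by blast
  define s where "s y = (P (y + h) - P y) /\<^sub>R h" for y
  define s' where "s' y = (p (y + h) - p y) /\<^sub>R h" for y
  have Ph: "((\<lambda>y. P (y + h)) has_vector_derivative p (y + h)) (at y)" for y
  proof -
    have "((\<lambda>y. y + h) has_vector_derivative 1) (at y)"
      by (auto simp: has_real_derivative_iff_has_vector_derivative[symmetric] intro!: derivative_eq_intros)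
    from vector_diff_chain_at[OF this P] show ?thesis by (simp add: o_def)
  qed
  have 1: "(s has_vector_derivative s' y) (at y)" for y
    unfolding s_def s'_def
    using has_vector_derivative_scaleR[OF DERIV_const has_vector_derivative_diff[OF Ph P], of "inverse h" y]
    by simp
  have lin: "norm (P (y + h) - P y - h *\<^sub>R u) \<le> h * C"
    if "\<And>x. x \<in> {y..y+h} \<Longrightarrow> norm (p x - u) \<le> C" for y u C
  proof -
    have "((\<lambda>x. P x - x *\<^sub>R u) has_vector_derivative (p x - u)) (at x within {y..y+h})" for x
      by (rule has_vector_derivative_eq_rhs[OF has_vector_derivative_diff[OF
            has_vector_derivative_at_within[OF P] has_vector_derivative_scaleR[OF DERIV_ident has_vector_derivative_const]]])
         simp
    then have d: "((\<lambda>x. P x - x *\<^sub>R u) has_derivative (\<lambda>v. v *\<^sub>R (p x - u))) (at x within {y..y+h})" for x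
      by (simp add: has_vector_derivative_def)
    have "norm ((P (y + h) - (y + h) *\<^sub>R u) - (P y - y *\<^sub>R u)) \<le> C * norm (y + h - y)"
      using h by (intro differentiable_bound[OF convex_real_interval(5) d])
         (auto simp: that onorm_scaleR_left onorm_id intro!: order_trans[OF onorm_scaleR_left_lemma])
    then show ?thesis using h by (simp add: algebra_simps)
  qed
  have 4: "norm (s y) \<le> P0" for y
  proof -
    have "norm (s y) = norm (P (y + h) - P y) / h"
      using h by (simp add: s_def divide_inverse mult.commute)
    then show ?thesis
      using lin[of y 0 P0] h p_bound by (simp add: pos_divide_le_eq mult.commute)
  qed
  have 5: "norm (p y - s y) \<le> (1 + 2 * M) / (2 * r)" for y
  proof -
    have "norm (p x - p y) \<le> (1 + 2 * M) / (2 * r)" if x: "x \<in> {y..y+h}" for x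
    proof -
      have "2 * norm (p x - p y) \<le> r * (x - y) + (B x - B y) / r"
        using p_modulus[of y x r] x r by simp
      also have "\<dots> \<le> r * h + (2 * M) / r"
        using x r B_bound[of x] B_bound[of y] by (intro add_mono mult_left_mono divide_right_mono) auto
      also have "\<dots> = (1 + 2 * M) / r"
        using r by (simp add: h_def power2_eq_square field_simps)
      finally show ?thesis using r by (simp add: field_simps)
    qed
    from lin[of y "p y", OF this] have "norm (P (y + h) - P y - h *\<^sub>R p y) \<le> h * ((1 + 2 * M) / (2 * r))" .
    moreover have "P (y + h) - P y - h *\<^sub>R p y = - (h *\<^sub>R (p y - s y))"
      using h by (simp add: s_def algebra_simps)
    moreover have "norm (- (h *\<^sub>R (p y - s y))) = h * norm (p y - s y)"
      using h by simp
    ultimately have "h * norm (p y - s y) \<le> h * ((1 + 2 * M) / (2 * r))" by (simp only:)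
    then show ?thesis by (simp only: mult_le_cancel_left_pos[OF h])
  qed
  have 6: "2 * norm (s' y) \<le> 1 + r\<^sup>2 * (B (y + 1 / r\<^sup>2) - B y)" for y
  proof -
    have "2 * norm (p (y + h) - p y) \<le> h + (B (y + h) - B y)"
      using p_modulus[of y "y + h" 1] h by simp
    then have "2 * norm (p (y + h) - p y) / h \<le> (h + (B (y + h) - B y)) / h"
      using h by (intro divide_right_mono) auto
    moreover have "2 * norm (s' y) = 2 * norm (p (y + h) - p y) / h"
      using h by (simp add: s'_def divide_inverse mult.commute)
    moreover have "(h + (B (y + h) - B y)) / h = 1 + r\<^sup>2 * (B (y + h) - B y)"
      using h by (simp add: add_divide_distrib) (simp add: h_def mult.commute)
    ultimately show ?thesis by (simp add: h_def)
  qed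
  have 3: "continuous_on UNIV s'"
    unfolding s'_def by (intro continuous_intros continuous_on_compose2[OF continuous_p]) auto
  have 2: "continuous_on UNIV s"
    using 1 by (meson continuous_at_imp_continuous_on has_vector_derivative_continuous)
  show ?thesis by (rule that[OF 1 2 3 4 5 6])
qed

text \<open>
  The difference quotient of \<open>B\<close> is the derivative of its average, which is bounded by \<open>M\<close>; hence its
  integral is bounded however long the interval.
\<close>

lemma integral_B_increment:
  assumes ax: "a \<le> x" and h: "0 < h"
  shows "integral {a..x} (\<lambda>y. B (y + h) - B y) \<le> 2 * M * h"
proof -
  obtain W where W: "\<And>x. (W has_vector_derivative B x) (at x)"
    using global_antiderivative[OF continuous_B] by blast
  then have W': "(W has_real_derivative B x) (at x)" for x
    by (simp add: has_real_derivative_iff_has_vector_derivative)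
  have bound: "\<bar>W (y + h) - W y\<bar> \<le> M * h" for y
  proof -
    obtain z where "W (y + h) - W y = h * B z"
      using MVT2[of y "y + h" W B] W' h by auto
    then show ?thesis using B_bound[of z] h by (simp add: abs_mult mult.commute)
  qed
  have "((\<lambda>y. W (y + h) - W y) has_real_derivative (B (y + h) - B y)) (at y)" for y
    using DERIV_diff[OF _ W'] DERIV_shift[of W "B (y + h)" y h] W' by (metis add.commute)
  from integral_unique[OF integral_derivative[OF this ax]]
  have "integral {a..x} (\<lambda>y. B (y + h) - B y) = (W (x + h) - W x) - (W (a + h) - W a)" .
  then show ?thesis using bound[of x] bound[of a] by linarith
qed

definition "decay_const = exp L * (P0 + 1 + 2 * M + P0 * L)"

lemma decay_const_nonneg: "0 \<le> decay_const"
  unfolding decay_const_def using M_nonneg P0_nonneg L_nonneg by (intro mult_nonneg_nonneg add_nonneg_nonneg) auto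

text \<open>
  With \<open>s\<close> the average for \<open>r = \<bar>z\<bar>\<close>, the function \<open>n = g + s f / (2 i z)\<close> satisfies
  \<open>n' = 2 i z n + G\<close>, where every term of \<open>G\<close> has a factor \<open>1 / z\<close> or \<open>p - s\<close>.  The number \<open>K\<close>
  bounds the damped length of the interval: it is \<open>1 / (2 \<delta>)\<close> when \<open>Im z \<ge> \<delta>\<close> and the actual
  length otherwise.  The first case gives the uniform rate, the second the mere limit.
\<close>

lemma g_decay:
  assumes z: "0 \<le> Im z" and z0: "z \<noteq> 0" and ax: "a \<le> x"
    and K: "integral {a..x} (\<lambda>y. exp (- 2 * Im z * (x - y))) \<le> K"
  shows "norm (g z x) \<le> norm (g z a) + decay_const * (1 + K) / norm z"
proof -
  define r where "r = norm z"
  have r: "0 < r" using z0 by (simp add: r_def)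
  obtain s s' where s: "\<And>y. (s has_vector_derivative s' y) (at y)"
    and cs: "continuous_on UNIV s" "continuous_on UNIV s'"
    and s_bound: "\<And>y. norm (s y) \<le> P0" and ps: "\<And>y. norm (p y - s y) \<le> (1 + 2 * M) / (2 * r)"
    and s': "\<And>y. 2 * norm (s' y) \<le> 1 + r\<^sup>2 * (B (y + 1 / r\<^sup>2) - B y)"
    using steklov_average[OF r] by blast
  define E where "E = exp L"
  have E: "0 < E" by (simp add: E_def)
  define n where "n y = g z y + s y * f z y / (2 * \<i> * z)" for y
  define G where "G y = (p y - s y) * f z y + (s' y * f z y + s y * (q y * g z y)) / (2 * \<i> * z)" for y
  have dn: "(n has_vector_derivative (2 * \<i> * z * n y + G y)) (at y)" for y
    unfolding n_def G_def
    by (rule has_vector_derivative_eq_rhs[OF has_vector_derivative_add[OF g_deriv[OF z]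
          has_vector_derivative_divide[OF has_vector_derivative_mult[OF s f_deriv[OF z]]]]])
       (use z0 in \<open>simp add: field_simps\<close>)
  have c: "continuous_on S p" "continuous_on S q" "continuous_on S s" "continuous_on S s'" "continuous_on S B" for S
    using continuous_p continuous_q cs continuous_B by (auto intro: continuous_on_subset)
  have cB: "continuous_on S (\<lambda>y. B (y + 1 / r\<^sup>2))" for S
    by (intro continuous_on_compose2[OF continuous_B] continuous_intros) auto
  note ci = integrable_continuous_real continuous_intros continuous_jost z c cB
  have cG: "continuous_on S G" for S
    unfolding G_def using z0 by (intro ci) auto
  let ?e = "\<lambda>y. exp (- 2 * Im z * (x - y))"
  define H where "H y = ?e y * (E * (3/4 + M) / r) + (r\<^sup>2 * (B (y + 1 / r\<^sup>2) - B y)) * (E / (4 * r))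
      + norm (q y) * (P0 * E / (2 * r))" for y
  have "integral {a..x} (\<lambda>y. ?e y * norm (G y)) \<le> integral {a..x} H"
  proof (intro integral_le)
    fix y assume y: "y \<in> {a..x}"
    have e: "0 \<le> ?e y" "?e y \<le> 1" using y z by auto
    let ?D = "r\<^sup>2 * (B (y + 1 / r\<^sup>2) - B y)"
    have D0: "0 \<le> ?D"
      using monoD[OF mono_B, of y "y + 1 / r\<^sup>2"] by simp
    have n2: "norm (2 * \<i> * z) = 2 * r" by (simp add: r_def norm_mult)
    have "norm (G y) \<le> norm ((p y - s y) * f z y) + (norm (s' y * f z y) + norm (s y * (q y * g z y))) / (2 * r)"
      unfolding G_def
      by (rule order_trans[OF norm_triangle_ineq])
         (auto simp: norm_divide n2 intro!: divide_right_mono norm_triangle_ineq simp: r_def)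
    also have "\<dots> \<le> (1 + 2 * M) / (2 * r) * E + ((1 + ?D) / 2 * E + P0 * (norm (q y) * E)) / (2 * r)"
      unfolding norm_mult E_def using s'[of y] ps s_bound norm_f_le[OF z] norm_g_le[OF z] r P0_nonneg M_nonneg D0
      by (intro add_mono mult_mono divide_right_mono) auto
    finally have "?e y * norm (G y) \<le> ?e y * \<dots>"
      using e by (intro mult_left_mono)
    also have "\<dots> = ?e y * (E * (3/4 + M) / r) + ?e y * (?D * (E / (4 * r)) + norm (q y) * (P0 * E / (2 * r)))"
      using r by (simp add: field_simps)
    also have "\<dots> \<le> ?e y * (E * (3/4 + M) / r) + 1 * (?D * (E / (4 * r)) + norm (q y) * (P0 * E / (2 * r)))"
      by (intro add_left_mono mult_right_mono[OF e(2)] add_nonneg_nonneg mult_nonneg_nonneg[OF D0])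
         (use E r P0_nonneg in simp_all)
    finally show "?e y * norm (G y) \<le> H y" by (simp add: H_def)
  qed (unfold H_def, (intro ci cG; use r in simp)+)
  also have "integral {a..x} H = integral {a..x} ?e * (E * (3/4 + M) / r)
      + (r\<^sup>2 * integral {a..x} (\<lambda>y. B (y + 1 / r\<^sup>2) - B y)) * (E / (4 * r))
      + integral {a..x} (\<lambda>y. norm (q y)) * (P0 * E / (2 * r))"
    unfolding H_def using r
    by (subst integral_add integral_mult_left integral_mult_right; (intro ci)?; simp?)+
  also have "\<dots> \<le> K * (E * (3/4 + M) / r) + (r\<^sup>2 * (2 * M * (1 / r\<^sup>2))) * (E / (4 * r)) + L * (P0 * E / (2 * r))"
    using K integral_B_increment[OF ax, of "1 / r\<^sup>2"] integral_potentials(1)[OF ax] A_diff_le[of x a] r E M_nonneg P0_nonneg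
    by (intro add_mono mult_right_mono mult_left_mono) auto
  also have "\<dots> = (K * (E * (3/4 + M)) + M * E / 2 + L * P0 * E / 2) / r"
    using r by (simp add: field_simps)
  finally have I: "integral {a..x} (\<lambda>y. ?e y * norm (G y)) \<le> (K * (E * (3/4 + M)) + M * E / 2 + L * P0 * E / 2) / r" .
  have ng: "norm (n y - g z y) \<le> P0 * E / 2 / r" for y
  proof -
    have "norm (n y - g z y) = norm (s y) * norm (f z y) / (2 * r)"
      by (simp add: n_def norm_mult norm_divide r_def)
    also have "\<dots> \<le> P0 * E / (2 * r)"
      unfolding E_def using s_bound norm_f_le[OF z] r P0_nonneg by (intro divide_right_mono mult_mono) auto
    finally show ?thesis by simp
  qed
  have "norm (g z x) \<le> norm (n x) + P0 * E / 2 / r" "norm (n a) \<le> norm (g z a) + P0 * E / 2 / r"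
    using ng[of x] ng[of a] norm_triangle_sub[of "g z x" "n x"] norm_triangle_sub[of "n a" "g z a"]
    by (auto simp: norm_minus_commute)
  moreover have "norm (n x) \<le> norm (n a) + integral {a..x} (\<lambda>y. ?e y * norm (G y))"
    by (rule damped_linear_ode_bound[OF ax z dn cG])
  ultimately have "norm (g z x) \<le> norm (g z a) + (P0 * E / 2 / r + P0 * E / 2 / r
      + (K * (E * (3/4 + M)) + M * E / 2 + L * P0 * E / 2) / r)"
    using I by linarith
  also have "\<dots> = norm (g z a) + (P0 * E + K * (E * (3/4 + M)) + M * E / 2 + L * P0 * E / 2) / r"
    by (simp add: add_divide_distrib)
  also have "\<dots> \<le> norm (g z a) + decay_const * (1 + K) / r"
  proof (intro add_left_mono divide_right_mono)
    have "0 \<le> integral {a..x} ?e" by (intro integral_nonneg ci) auto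
    then have K0: "0 \<le> K" using K by simp
    have "decay_const * (1 + K) - (P0 * E + K * (E * (3/4 + M)) + M * E / 2 + L * P0 * E / 2)
      = E * (1 + M * 3 / 2 + L * P0 / 2 + K * (P0 + 1/4 + M + P0 * L))"
      by (simp add: decay_const_def E_def algebra_simps)
    also have "\<dots> \<ge> 0"
      using E M_nonneg P0_nonneg L_nonneg K0 by (intro mult_nonneg_nonneg add_nonneg_nonneg) auto
    finally show "P0 * E + K * (E * (3/4 + M)) + M * E / 2 + L * P0 * E / 2 \<le> decay_const * (1 + K)" by simp
  qed (use r in simp)
  finally show ?thesis by (simp add: r_def)
qed

lemma f_decay:
  assumes z: "0 \<le> Im z" and ax: "a \<le> x" and S: "\<And>y. y \<in> {a..x} \<Longrightarrow> norm (g z y) \<le> S"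
  shows "norm (f z x - 1) \<le> norm (f z a - 1) + S * L"
proof -
  have cq: "continuous_on T q" for T using continuous_q by (rule continuous_on_subset) simp
  have S0: "0 \<le> S" using S[of a] ax norm_ge_zero order_trans by (metis atLeastAtMost_iff order_refl)
  have "norm (f z x - 1) \<le> norm (f z a - 1) + integral {a..x} (\<lambda>y. exp (- 2 * Im 0 * (x - y)) * norm (q y * g z y))"
  proof (rule damped_linear_ode_bound[OF ax])
    show "((\<lambda>x. f z x - 1) has_vector_derivative 2 * \<i> * 0 * (f z y - 1) + q y * g z y) (at y)" for y
      by (rule has_vector_derivative_eq_rhs[OF has_vector_derivative_diff[OF f_deriv[OF z] has_vector_derivative_const]]) simp
  qed (auto intro!: continuous_intros continuous_q continuous_jost z)
  also have "integral {a..x} (\<lambda>y. exp (- 2 * Im 0 * (x - y)) * norm (q y * g z y)) \<le> integral {a..x} (\<lambda>y. S * norm (q y))"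
    using S by (intro integral_le integrable_continuous_real continuous_intros cq continuous_jost z)
       (auto simp: norm_mult mult.commute[of S] intro!: mult_left_mono)
  also have "\<dots> = S * integral {a..x} (\<lambda>y. norm (q y))" by simp
  also have "\<dots> \<le> S * L"
    using integral_potentials(1)[OF ax] A_diff_le[of x a] S0 by (intro mult_left_mono) linarith+
  finally show ?thesis by simp
qed

lemma jost_rate:
  assumes \<delta>: "0 < \<delta>" and z: "\<delta> \<le> Im z"
  shows "norm (g z x) \<le> decay_const * (1 + 1 / (2 * \<delta>)) / norm z"
    and "norm (f z x - 1) \<le> decay_const * (1 + 1 / (2 * \<delta>)) / norm z * L"
proof -
  have z': "0 \<le> Im z" "z \<noteq> 0" using z \<delta> by auto
  have g: "norm (g z y) \<le> decay_const * (1 + 1 / (2 * \<delta>)) / norm z" for y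
  proof (rule le_limit_at_bot)
    show "((\<lambda>a. norm (g z a) + decay_const * (1 + 1 / (2 * \<delta>)) / norm z) \<longlongrightarrow>
        decay_const * (1 + 1 / (2 * \<delta>)) / norm z) at_bot"
      using tendsto_add[OF tendsto_norm[OF g_at_bot[OF z'(1)]] tendsto_const] by fastforce
    fix a assume a: "a \<le> y"
    show "norm (g z y) \<le> norm (g z a) + decay_const * (1 + 1 / (2 * \<delta>)) / norm z"
    proof (rule g_decay[OF z' a])
      have "integral {a..y} (\<lambda>s. exp (- 2 * Im z * (y - s))) \<le> 1 / (2 * Im z)"
        using z \<delta> by (intro damping_factor_integral a) auto
      also have "\<dots> \<le> 1 / (2 * \<delta>)" using z \<delta> by (simp add: field_simps)
      finally show "integral {a..y} (\<lambda>s. exp (- 2 * Im z * (y - s))) \<le> 1 / (2 * \<delta>)" .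
    qed
  qed
  then show "norm (g z x) \<le> decay_const * (1 + 1 / (2 * \<delta>)) / norm z" .
  show "norm (f z x - 1) \<le> decay_const * (1 + 1 / (2 * \<delta>)) / norm z * L"
  proof (rule le_limit_at_bot)
    have "((\<lambda>a. norm (f z a - 1) + decay_const * (1 + 1 / (2 * \<delta>)) / norm z * L) \<longlongrightarrow>
        norm (1 - 1 :: complex) + decay_const * (1 + 1 / (2 * \<delta>)) / norm z * L) at_bot"
      by (intro tendsto_intros f_at_bot z')
    then show "((\<lambda>a. norm (f z a - 1) + decay_const * (1 + 1 / (2 * \<delta>)) / norm z * L) \<longlongrightarrow>
        decay_const * (1 + 1 / (2 * \<delta>)) / norm z * L) at_bot" by simp
  qed (rule f_decay[OF z'(1) _ g])
qed

text \<open>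
  Up to the real line there is no uniform rate.  The point \<open>a\<close> is chosen first, so far to the left that
  the tail is small for every \<open>z\<close>; then \<open>\<bar>z\<bar>\<close> is taken large compared with \<open>x - a\<close>.
\<close>

lemma jost_limit:
  shows "((\<lambda>z. f z x) \<longlongrightarrow> 1) (inf at_infinity (principal {z. 0 \<le> Im z}))"
    and "((\<lambda>z. g z x) \<longlongrightarrow> 0) (inf at_infinity (principal {z. 0 \<le> Im z}))"
proof -
  have key: "\<forall>\<^sub>F z in inf at_infinity (principal {z. 0 \<le> Im z}). norm (f z x - 1) < e \<and> norm (g z x) < e"
    if e: "0 < e" for e
  proof -
    have "((\<lambda>a. A a * exp L * (1 + L)) \<longlongrightarrow> 0 * exp L * (1 + L)) at_bot"
      by (intro tendsto_intros A_at_bot)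
    then have "\<forall>\<^sub>F a in at_bot. A a * exp L * (1 + L) < e / 2"
      using e by (intro order_tendstoD) auto
    then have "\<forall>\<^sub>F a in at_bot. A a * exp L * (1 + L) < e / 2 \<and> a < x"
      using eventually_gt_at_bot[of x] by (auto simp: eventually_conj_iff)
    then obtain a where a: "A a * exp L * (1 + L) < e / 2" "a < x"
      by (metis (mono_tags, lifting) eventually_happens trivial_limit_at_bot_linorder)
    define C where "C = decay_const * (1 + (x - a)) * (1 + L)"
    have C: "0 \<le> C" using a decay_const_nonneg L_nonneg by (simp add: C_def)
    have L1: "1 \<le> 1 + L" using L_nonneg by simp
    have "norm (f z x - 1) < e \<and> norm (g z x) < e" if z: "0 \<le> Im z" and big: "2 * C / e + 1 \<le> norm z" for z
    proof -
      have pos: "0 < norm z" using big C e by (smt (verit) divide_nonneg_pos)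
      then have z0: "z \<noteq> 0" by auto
      define S where "S = A a * exp L + decay_const * (1 + (x - a)) / norm z"
      have S0: "0 \<le> S" using A_nonneg[of a] decay_const_nonneg a by (simp add: S_def)
      have tail: "norm (g z a) \<le> A a * exp L" "norm (f z a - 1) \<le> A a * exp L"
        using jost_tail[OF z, of a] by (smt (verit) norm_ge_zero)+
      have g: "norm (g z y) \<le> S" if y: "y \<in> {a..x}" for y
      proof -
        have "integral {a..y} (\<lambda>s. exp (- 2 * Im z * (y - s))) \<le> y - a"
          using y z by (intro damping_factor_integral) auto
        then have "integral {a..y} (\<lambda>s. exp (- 2 * Im z * (y - s))) \<le> x - a" using y by simp
        from g_decay[OF z z0 _ this] y tail show ?thesis by (simp add: S_def)
      qed
      have "C / norm z < e / 2"
        using big C e pos by (simp add: field_simps)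
      moreover have "S * (1 + L) = A a * exp L * (1 + L) + C / norm z"
        by (simp add: S_def C_def algebra_simps add_divide_distrib)
      ultimately have S: "S * (1 + L) < e" using a(1) by linarith
      have SL: "S \<le> S * (1 + L)" using S0 L1 by (simp add: mult_le_cancel_left1)
      have "norm (f z x - 1) \<le> norm (f z a - 1) + S * L"
        by (rule f_decay[OF z _ g]) (use a in auto)
      also have "norm (f z a - 1) \<le> A a * exp L" by (rule tail)
      also have "A a * exp L \<le> S" using decay_const_nonneg a by (simp add: S_def)
      finally show ?thesis using S SL g[of x] a by (simp add: algebra_simps)
    qed
    then show ?thesis
      by (auto simp: eventually_inf_principal eventually_at_infinity)
  qed
  show "((\<lambda>z. f z x) \<longlongrightarrow> 1) (inf at_infinity (principal {z. 0 \<le> Im z}))"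
    "((\<lambda>z. g z x) \<longlongrightarrow> 0) (inf at_infinity (principal {z. 0 \<le> Im z}))"
    unfolding tendsto_iff dist_norm using key by (simp_all add: eventually_conj_iff)
qed

end

section \<open>Admissible potentials\<close>

text \<open>
  Integrability and the increment condition, phrased through bounded primitives so that the
  class is visibly invariant under reflection of the line; that is why no limits of \<open>A\<close> and \<open>B\<close> are prescribed.
\<close>

definition admissible_potential :: "(real \<Rightarrow> complex) \<Rightarrow> bool" where
  "admissible_potential u \<longleftrightarrow> continuous_on UNIV u \<and>
     (\<exists>A L. \<forall>x. (A has_real_derivative norm (u x)) (at x) \<and> \<bar>A x\<bar> \<le> L) \<and>
     (\<exists>B M. continuous_on UNIV B \<and> mono B \<and> (\<forall>x. \<bar>B x\<bar> \<le> M) \<and>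
        (\<forall>x y c. x \<le> y \<longrightarrow> 0 < c \<longrightarrow> 2 * norm (u y - u x) \<le> c * (y - x) + (B y - B x) / c))"

lemma admissible_potentialE:
  assumes "admissible_potential u"
  obtains A L B M where "continuous_on UNIV u"
    and "\<forall>x. (A has_real_derivative norm (u x)) (at x)" and "\<forall>x. \<bar>A x\<bar> \<le> L"
    and "continuous_on UNIV B" and "mono B" and "\<forall>x. \<bar>B x\<bar> \<le> M"
    and "\<forall>x y c. x \<le> y \<longrightarrow> 0 < c \<longrightarrow> 2 * norm (u y - u x) \<le> c * (y - x) + (B y - B x) / c"
proof -
  from assms obtain A L B M where *: "continuous_on UNIV u"
      "\<forall>x. (A has_real_derivative norm (u x)) (at x) \<and> \<bar>A x\<bar> \<le> L"
      "continuous_on UNIV B" "mono B" "\<forall>x. \<bar>B x\<bar> \<le> M"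
      "\<forall>x y c. x \<le> y \<longrightarrow> 0 < c \<longrightarrow> 2 * norm (u y - u x) \<le> c * (y - x) + (B y - B x) / c"
    unfolding admissible_potential_def by (elim conjE exE)
  show ?thesis by (rule that[of A L B M]) (use * in \<open>simp_all\<close>)
qed

lemma admissible_isometry:
  assumes "admissible_potential u" and "\<And>x. norm (v x) = norm (u x)"
    and "\<And>x y. norm (v x - v y) = norm (u x - u y)"
  shows "admissible_potential v"
proof -
  have "continuous_on UNIV v"
    using assms(1) unfolding admissible_potential_def continuous_on_iff dist_norm assms(3) by blast
  then show ?thesis
    using assms(1) unfolding admissible_potential_def assms(2,3) by blast
qed

lemma admissible_reflection:
  assumes "admissible_potential u"
  shows "admissible_potential (\<lambda>x. u (- x))"
proof -
  obtain A L B M where c: "continuous_on UNIV u"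
    and A': "\<forall>x. (A has_real_derivative norm (u x)) (at x)" "\<forall>x. \<bar>A x\<bar> \<le> L"
    and B: "continuous_on UNIV B" "mono B" and B': "\<forall>x. \<bar>B x\<bar> \<le> M"
    and m': "\<forall>x y c. x \<le> y \<longrightarrow> 0 < c \<longrightarrow> 2 * norm (u y - u x) \<le> c * (y - x) + (B y - B x) / c"
    by (rule admissible_potentialE[OF assms])
  note A = A'[rule_format] and BM = B'[rule_format] and m = m'[rule_format]
  have "((\<lambda>x. - A (- x)) has_real_derivative norm (u (- x))) (at x)" for x
    by (rule derivative_eq_intros DERIV_chain2[OF A(1)] refl | simp)+
  then have 1: "\<exists>A L. \<forall>x. (A has_real_derivative norm (u (- x))) (at x) \<and> \<bar>A x\<bar> \<le> L"
    using A(2) by (intro exI[of _ "\<lambda>x. - A (- x)"] exI[of _ L]) auto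
  have "continuous_on UNIV (\<lambda>x. - B (- x))"
    by (intro continuous_intros continuous_on_compose2[OF B(1)]) auto
  moreover have "mono (\<lambda>x. - B (- x))" using B(2) by (auto simp: mono_def)
  moreover have "2 * norm (u (- y) - u (- x)) \<le> c * (y - x) + (- B (- y) - - B (- x)) / c"
    if "x \<le> y" "0 < c" for x y c
    using m[of "- y" "- x" c] that by (simp add: norm_minus_commute)
  ultimately have 2: "\<exists>B M. continuous_on UNIV B \<and> mono B \<and> (\<forall>x. \<bar>B x\<bar> \<le> M) \<and>
        (\<forall>x y c. x \<le> y \<longrightarrow> 0 < c \<longrightarrow> 2 * norm (u (- y) - u (- x)) \<le> c * (y - x) + (B y - B x) / c)"
    using BM by (intro exI[of _ "\<lambda>x. - B (- x)"] exI[of _ M]) auto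
  have 3: "continuous_on UNIV (\<lambda>x. u (- x))"
    by (intro continuous_intros continuous_on_compose2[OF c]) auto
  show ?thesis unfolding admissible_potential_def using 1 2 3 by blast
qed

text \<open>
  By the mean value theorem some value on \<open>[x, x + 1]\<close> is at most the mass of that interval, and the
  increment condition carries the bound over to \<open>x\<close>.
\<close>

lemma admissible_bounded:
  assumes "admissible_potential u"
  obtains C where "\<And>x. norm (u x) \<le> C"
proof -
  obtain A L B M where c: "continuous_on UNIV u"
    and A': "\<forall>x. (A has_real_derivative norm (u x)) (at x)" "\<forall>x. \<bar>A x\<bar> \<le> L"
    and B: "continuous_on UNIV B" "mono B" and B': "\<forall>x. \<bar>B x\<bar> \<le> M"
    and m': "\<forall>x y c. x \<le> y \<longrightarrow> 0 < c \<longrightarrow> 2 * norm (u y - u x) \<le> c * (y - x) + (B y - B x) / c"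
    by (rule admissible_potentialE[OF assms])
  note A = A'[rule_format] and BM = B'[rule_format] and m = m'[rule_format]
  have "norm (u x) \<le> 2 * L + 1 / 2 + M" for x
  proof -
    obtain s where s: "x < s" "s < x + 1" "A (x + 1) - A x = (x + 1 - x) * norm (u s)"
      using MVT2[of x "x + 1" A "\<lambda>s. norm (u s)"] A(1) by auto
    then have "norm (u s) \<le> 2 * L" using A(2)[of x] A(2)[of "x + 1"] by simp
    moreover have "2 * norm (u s - u x) \<le> 1 + 2 * M"
      using m[of x s 1] s BM[of s] BM[of x] by simp
    moreover have "norm (u x) \<le> norm (u s) + norm (u s - u x)"
      by (metis norm_minus_commute norm_triangle_sub)
    ultimately show ?thesis by linarith
  qed
  then show ?thesis by (rule that)
qed

lemma primitive_continuous:
  fixes h H :: "real \<Rightarrow> 'a::banach"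
  assumes "\<And>a b. a \<le> b \<Longrightarrow> (h has_integral (H b - H a)) {a..b}"
  shows "continuous_on UNIV H"
  unfolding continuous_on_eq_continuous_at[OF open_UNIV]
proof
  fix x :: real
  have "continuous_on {x - 1..x + 1} (\<lambda>y. H (x - 1) + integral {x - 1..y} h)"
    using assms by (intro continuous_intros indefinite_integral_continuous_1 has_integral_integrable[OF assms]) simp
  then have "continuous_on {x - 1..x + 1} H"
  proof (rule continuous_on_eq)
    fix y assume "y \<in> {x - 1..x + 1}"
    then show "H (x - 1) + integral {x - 1..y} h = H y"
      using integral_unique[OF assms, of "x - 1" y] by simp
  qed
  then show "isCont H x"
    by (rule continuous_on_interior) simp
qed

lemma bounded_primitive:
  fixes h :: "real \<Rightarrow> real"
  assumes h: "integrable lebesgue h" and pos: "\<And>x. 0 \<le> h x"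
  obtains H C where "\<forall>a b. a \<le> b \<longrightarrow> (h has_integral (H b - H a)) {a..b}"
    and "mono H" and "\<forall>x. \<bar>H x\<bar> \<le> C"
proof -
  have int: "h integrable_on S" if "S \<in> sets lebesgue" for S
  proof (rule set_lebesgue_integral_eq_integral(1))
    have "set_integrable lebesgue UNIV h" using h by (simp add: set_integrable_def)
    then show "set_integrable lebesgue S h" using that by (rule set_integrable_subset) simp
  qed
  define H where "H y = integral {..y} h" for y
  have H: "(h has_integral (H b - H a)) {a..b}" if "a \<le> b" for a b
  proof -
    have "(h has_integral (integral {..a} h + integral {a..b} h)) ({..a} \<union> {a..b})"
      using that by (intro has_integral_Un integrable_integral int) auto
    moreover have "{..a} \<union> {a..b} = {..b}" using that by auto
    ultimately have "integral {a..b} h = H b - H a"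
      by (simp add: H_def integral_unique)
    then show ?thesis using integrable_integral[OF int, of "{a..b}"] by simp
  qed
  moreover have "mono H"
  proof
    fix a b :: real assume "a \<le> b"
    from has_integral_nonneg[OF H[OF this]] pos show "H a \<le> H b" by simp
  qed
  moreover have "\<bar>H y\<bar> \<le> integral UNIV h" for y
  proof -
    have "0 \<le> H y" unfolding H_def by (intro integral_nonneg int) (auto simp: pos)
    moreover have "H y \<le> integral UNIV h"
      unfolding H_def by (intro integral_subset_le int) (auto simp: pos)
    ultimately show ?thesis by simp
  qed
  ultimately show ?thesis using that by blast
qed

text \<open>
  The inequality \<open>2 \<bar>u\<bar> \<le> 1 / (1 + x\<^sup>2) + (1 + x\<^sup>2) \<bar>u\<bar>\<^sup>2\<close> bounds the primitive of \<open>\<bar>u\<bar>\<close> by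
  \<open>arctan\<close> plus the weighted norm, and \<open>2 \<bar>u'\<bar> \<le> c + \<bar>u'\<bar>\<^sup>2 / c\<close> integrates to the increment condition.
\<close>

lemma admissible_H11:
  assumes "H11 u"
  shows "admissible_potential u"
proof -
  have L21: "integrable lebesgue (\<lambda>x. (norm (sqrt (1 + x\<^sup>2) *\<^sub>R u x))\<^sup>2)"
    and Du: "integrable lebesgue (\<lambda>x. (norm (Dx u x))\<^sup>2)"
    and ftc: "\<And>a b. a \<le> b \<Longrightarrow> (Dx u has_integral (u b - u a)) {a..b}"
    using assms unfolding H11_def L21_def H1_def L2_def by blast+
  have cont: "continuous_on UNIV u" by (rule primitive_continuous[OF ftc])
  have cn: "continuous_on S (\<lambda>x. norm (u x))" for S
    by (intro continuous_intros continuous_on_subset[OF cont]) auto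
  obtain W C where "mono W"
    and W': "\<forall>a b. a \<le> b \<longrightarrow> ((\<lambda>x. (norm (sqrt (1 + x\<^sup>2) *\<^sub>R u x))\<^sup>2) has_integral (W b - W a)) {a..b}"
    and WC: "\<forall>x. \<bar>W x\<bar> \<le> C"
    by (rule bounded_primitive[OF L21 zero_le_power2])
  note W = W'[rule_format]
  obtain A where A': "\<And>x. (A has_vector_derivative norm (u x)) (at x)"
    using global_antiderivative[OF cn] by blast
  then have A: "(A has_real_derivative norm (u x)) (at x)" for x
    by (simp add: has_real_derivative_iff_has_vector_derivative)
  have A_le: "\<bar>A b - A a\<bar> \<le> pi + 2 * C" if ab: "a \<le> b" for a b
  proof -
    have "((\<lambda>x. inverse (1 + x\<^sup>2)) has_integral (arctan b - arctan a)) {a..b}"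
      by (rule integral_derivative[OF DERIV_arctan ab])
    from has_integral_add[OF this W[OF ab]]
    have "A b - A a \<le> arctan b - arctan a + (W b - W a)"
    proof (rule has_integral_le[OF integral_derivative[OF A ab]])
      fix x
      let ?s = "sqrt (1 + x\<^sup>2)"
      have s: "0 < ?s" "?s\<^sup>2 = 1 + x\<^sup>2" by (auto simp: add_pos_nonneg)
      have "0 \<le> (inverse ?s - ?s * norm (u x))\<^sup>2" by simp
      also have "\<dots> = inverse (?s\<^sup>2) + (?s * norm (u x))\<^sup>2 - 2 * norm (u x)"
        using s(1) by (simp add: power2_diff power_inverse)
      also have "\<dots> = inverse (1 + x\<^sup>2) + (norm (?s *\<^sub>R u x))\<^sup>2 - 2 * norm (u x)"
        unfolding s(2) using s(1) by simp
      finally show "norm (u x) \<le> inverse (1 + x\<^sup>2) + (norm (?s *\<^sub>R u x))\<^sup>2"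
        using norm_ge_zero[of "u x"] by linarith
    qed
    moreover have "A a \<le> A b"
      using has_integral_nonneg[OF integral_derivative[OF A ab]] by simp
    ultimately show ?thesis using WC[rule_format, of a] WC[rule_format, of b]
        arctan_lbound[of a] arctan_ubound[of b] by linarith
  qed
  have 1: "\<exists>A L. \<forall>x. (A has_real_derivative norm (u x)) (at x) \<and> \<bar>A x\<bar> \<le> L"
  proof (intro exI allI conjI)
    show "((\<lambda>x. A x - A 0) has_real_derivative norm (u x)) (at x)" for x
      using DERIV_diff[OF A DERIV_const] by simp
    show "\<bar>A x - A 0\<bar> \<le> pi + 2 * C" for x
      using A_le[of 0 x] A_le[of x 0] by (cases "0 \<le> x") auto
  qed
  obtain B M where mB: "mono B" and BM: "\<forall>x. \<bar>B x\<bar> \<le> M"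
    and B': "\<forall>a b. a \<le> b \<longrightarrow> ((\<lambda>x. (norm (Dx u x))\<^sup>2) has_integral (B b - B a)) {a..b}"
    by (rule bounded_primitive[OF Du zero_le_power2])
  note B = B'[rule_format]
  have "2 * norm (u y - u x) \<le> c * (y - x) + (B y - B x) / c" if xy: "x \<le> y" and c: "0 < c" for x y c
  proof -
    have r: "((\<lambda>s. c + (norm (Dx u s))\<^sup>2 / c) has_integral (c * (y - x) + (B y - B x) / c)) {x..y}"
      using has_integral_add[OF has_integral_const_real[of c x y] has_integral_divide[OF B[OF xy], of c]] xy
      by (simp add: mult.commute)
    have l: "((\<lambda>s. 2 * Dx u s) has_integral (2 * (u y - u x))) {x..y}"
      by (intro has_integral_mult_right ftc xy)
    have "norm (2 * Dx u s) \<le> c + (norm (Dx u s))\<^sup>2 / c" for s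
    proof -
      have "0 \<le> (c - norm (Dx u s))\<^sup>2 / c" using c by simp
      also have "\<dots> = c + (norm (Dx u s))\<^sup>2 / c - 2 * norm (Dx u s)"
        using c by (simp add: power2_diff field_simps power2_eq_square)
      finally show ?thesis by (simp add: norm_mult)
    qed
    then have "norm (integral {x..y} (\<lambda>s. 2 * Dx u s)) \<le> integral {x..y} (\<lambda>s. c + (norm (Dx u s))\<^sup>2 / c)"
      by (intro Henstock_Kurzweil_Integration.integral_norm_bound_integral
                has_integral_integrable[OF l] has_integral_integrable[OF r])
    then have "norm (2 * (u y - u x)) \<le> c * (y - x) + (B y - B x) / c"
      unfolding integral_unique[OF l] integral_unique[OF r] .
    then show ?thesis by (simp only: norm_mult norm_numeral)
  qed
  moreover have "continuous_on UNIV B" by (rule primitive_continuous[OF B])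
  ultimately have 2: "\<exists>B M. continuous_on UNIV B \<and> mono B \<and> (\<forall>x. \<bar>B x\<bar> \<le> M) \<and>
        (\<forall>x y c. x \<le> y \<longrightarrow> 0 < c \<longrightarrow> 2 * norm (u y - u x) \<le> c * (y - x) + (B y - B x) / c)"
    using mB BM by blast
  show ?thesis unfolding admissible_potential_def using cont 1 2 by blast
qed

lemma bounded_mono_limit_at_bot:
  fixes A :: "real \<Rightarrow> real"
  assumes "mono A" and "\<And>x. \<bar>A x\<bar> \<le> C"
  obtains l where "(A \<longlongrightarrow> l) at_bot" "\<bar>l\<bar> \<le> C"
proof -
  have lower: "- C \<le> A x" for x using assms(2)[of x] by linarith
  then have bdd: "bdd_below (range A)" by (intro bdd_belowI[of _ "- C"]) auto
  have "(A \<longlongrightarrow> Inf (range A)) at_bot"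
  proof (rule decreasing_tendsto)
    show "\<forall>\<^sub>F x in at_bot. Inf (range A) \<le> A x" using bdd by (intro always_eventually allI cInf_lower) auto
    fix y assume "Inf (range A) < y"
    then obtain a where "A a < y" using cInf_lessD[of "range A" y] by auto
    then have "\<forall>x\<le>a. A x < y" using monoD[OF assms(1)] order_le_less_trans by blast
    then show "\<forall>\<^sub>F x in at_bot. A x < y" unfolding eventually_at_bot_linorder by blast
  qed
  moreover have "\<bar>Inf (range A)\<bar> \<le> C"
  proof -
    have "- C \<le> Inf (range A)" using lower by (intro cInf_greatest) auto
    moreover have "Inf (range A) \<le> A 0" using bdd by (intro cInf_lower) auto
    ultimately show ?thesis using assms(2)[of 0] by linarith
  qed
  ultimately show ?thesis by (rule that)
qed

section \<open>Normalized functions on the upper half plane\<close>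

text \<open>
  The scalar form of the analytic part of the Riemann-Hilbert problem.
\<close>

definition half_plane_normalized :: "complex \<Rightarrow> (complex \<Rightarrow> complex) \<Rightarrow> bool" where
  "half_plane_normalized c f \<longleftrightarrow>
     f holomorphic_on {z. 0 < Im z} \<and> continuous_on {z. 0 \<le> Im z} f \<and>
     (f \<longlongrightarrow> c) (inf at_infinity (principal {z. 0 \<le> Im z})) \<and>
     (\<forall>\<delta>>0. (\<lambda>z. f z - c) \<in> O[inf at_infinity (principal {z. \<delta> \<le> Im z})](\<lambda>z. 1 / z))"

lemma half_plane_normalizedD:
  assumes "half_plane_normalized c f"
  shows "f holomorphic_on {z. 0 < Im z}" "continuous_on {z. 0 \<le> Im z} f"
    "(f \<longlongrightarrow> c) (inf at_infinity (principal {z. 0 \<le> Im z}))"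
    "0 < \<delta> \<Longrightarrow> (\<lambda>z. f z - c) \<in> O[inf at_infinity (principal {z. \<delta> \<le> Im z})](\<lambda>z. 1 / z)"
  using assms unfolding half_plane_normalized_def by blast+

lemma half_plane_filter_le:
  "0 < \<delta> \<Longrightarrow> inf at_infinity (principal {z. \<delta> \<le> Im z}) \<le> inf at_infinity (principal {z. 0 \<le> Im z})"
  by (intro inf_mono) auto

lemma half_plane_tendsto_bigo_1:
  fixes f :: "complex \<Rightarrow> complex"
  assumes "(f \<longlongrightarrow> c) (inf at_infinity (principal {z. 0 \<le> Im z}))" "0 < \<delta>"
  shows "f \<in> O[inf at_infinity (principal {z. \<delta> \<le> Im z})](\<lambda>_. 1)"
  using tendsto_mono[OF half_plane_filter_le[OF assms(2)] assms(1)]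
  by (intro bigoI_tendsto[where c = c]) simp_all

lemma half_plane_normalized_mult:
  assumes f: "half_plane_normalized c f" and g: "half_plane_normalized d g"
  shows "half_plane_normalized (c * d) (\<lambda>z. f z * g z)"
proof -
  note F = half_plane_normalizedD[OF f] and G = half_plane_normalizedD[OF g]
  have "(\<lambda>z. f z * g z - c * d) \<in> O[inf at_infinity (principal {z. \<delta> \<le> Im z})](\<lambda>z. 1 / z)" (is "_ \<in> O[?F](_)")
    if \<delta>: "0 < \<delta>" for \<delta>
  proof -
    have "(\<lambda>z. (f z - c) * g z) \<in> O[?F](\<lambda>z. 1 / z * 1)"
      by (rule landau_o.big.mult[OF F(4)[OF \<delta>] half_plane_tendsto_bigo_1[OF G(3) \<delta>]])
    then have "(\<lambda>z. (f z - c) * g z) \<in> O[?F](\<lambda>z. 1 / z)" by (simp only: mult_1_right)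
    moreover have "(\<lambda>z. c * (g z - d)) \<in> O[?F](\<lambda>z. 1 * (1 / z))"
      by (rule landau_o.big.mult[OF half_plane_tendsto_bigo_1[OF tendsto_const \<delta>] G(4)[OF \<delta>]])
    then have "(\<lambda>z. c * (g z - d)) \<in> O[?F](\<lambda>z. 1 / z)" by (simp only: mult_1_left)
    ultimately have "(\<lambda>z. (f z - c) * g z + c * (g z - d)) \<in> O[?F](\<lambda>z. 1 / z)"
      by (rule sum_in_bigo(1))
    moreover have "(\<lambda>z. (f z - c) * g z + c * (g z - d)) = (\<lambda>z. f z * g z - c * d)"
      by (simp add: algebra_simps)
    ultimately show ?thesis by simp
  qed
  then show ?thesis
    unfolding half_plane_normalized_def
    using holomorphic_on_mult[OF F(1) G(1)] continuous_on_mult[OF F(2) G(2)] tendsto_mult[OF F(3) G(3)]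
    by blast
qed

lemma half_plane_normalized_diff:
  assumes f: "half_plane_normalized c f" and g: "half_plane_normalized d g"
  shows "half_plane_normalized (c - d) (\<lambda>z. f z - g z)"
proof -
  note F = half_plane_normalizedD[OF f] and G = half_plane_normalizedD[OF g]
  have "(\<lambda>z. f z - g z - (c - d)) \<in> O[inf at_infinity (principal {z. \<delta> \<le> Im z})](\<lambda>z. 1 / z)"
    if \<delta>: "0 < \<delta>" for \<delta>
    using sum_in_bigo(2)[OF F(4)[OF \<delta>] G(4)[OF \<delta>]] by (simp only: diff_diff_eq2 diff_diff_add algebra_simps)
  then show ?thesis
    unfolding half_plane_normalized_def
    using holomorphic_on_diff[OF F(1) G(1)] continuous_on_diff[OF F(2) G(2)] tendsto_diff[OF F(3) G(3)]
    by blast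
qed

text \<open>
  For the rate, \<open>1 / a - 1 = - (a - 1) / a\<close>, and \<open>1 / a\<close> is bounded near infinity.
\<close>

lemma half_plane_normalized_inverse:
  assumes a: "half_plane_normalized 1 a" and nz: "\<And>z. 0 \<le> Im z \<Longrightarrow> a z \<noteq> 0"
  shows "half_plane_normalized 1 (\<lambda>z. 1 / a z)"
proof -
  note A = half_plane_normalizedD[OF a]
  have lim: "((\<lambda>z. 1 / a z) \<longlongrightarrow> 1) (inf at_infinity (principal {z. 0 \<le> Im z}))"
    using tendsto_divide[OF tendsto_const A(3), of 1] by simp
  have "(\<lambda>z. 1 / a z - 1) \<in> O[inf at_infinity (principal {z. \<delta> \<le> Im z})](\<lambda>z. 1 / z)" (is "_ \<in> O[?F](_)")
    if \<delta>: "0 < \<delta>" for \<delta>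
  proof -
    have "(\<lambda>z. (a z - 1) * (1 / a z)) \<in> O[?F](\<lambda>z. 1 / z * 1)"
      by (rule landau_o.big.mult[OF A(4)[OF \<delta>] half_plane_tendsto_bigo_1[OF lim \<delta>]])
    then have "(\<lambda>z. - ((a z - 1) * (1 / a z))) \<in> O[?F](\<lambda>z. 1 / z)"
      by (simp only: mult_1_right landau_o.big.uminus_in_iff)
    moreover have "\<forall>\<^sub>F z in ?F. - ((a z - 1) * (1 / a z)) = 1 / a z - 1"
      unfolding eventually_inf_principal
      by (rule always_eventually) (use nz \<delta> in \<open>auto simp: field_simps\<close>)
    ultimately show ?thesis by (simp only: landau_o.big.in_cong)
  qed
  moreover have "(\<lambda>z. 1 / a z) holomorphic_on {z. 0 < Im z}" "continuous_on {z. 0 \<le> Im z} (\<lambda>z. 1 / a z)"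
    using nz by (auto intro!: holomorphic_on_divide continuous_on_divide A holomorphic_on_const continuous_on_const)
  ultimately show ?thesis
    unfolding half_plane_normalized_def using lim by blast
qed

text \<open>
  The primitives in \<open>admissible_potential\<close> are only bounded; subtracting the limit at \<open>-\<infinity>\<close> of the
  monotone function \<open>A0\<close> gives the normalized primitive of \<open>potential_pair\<close>.
\<close>

lemma half_plane_normalized_jost:
  assumes q: "admissible_potential q" and p: "admissible_potential p"
    and f_deriv: "\<And>z x. 0 \<le> Im z \<Longrightarrow> (f z has_vector_derivative q x * g z x) (at x)"
    and g_deriv: "\<And>z x. 0 \<le> Im z \<Longrightarrow>
          (g z has_vector_derivative p x * f z x + 2 * \<i> * z * g z x) (at x)"
    and f_at_bot: "\<And>z. 0 \<le> Im z \<Longrightarrow> (f z \<longlongrightarrow> 1) at_bot"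
    and g_at_bot: "\<And>z. 0 \<le> Im z \<Longrightarrow> (g z \<longlongrightarrow> 0) at_bot"
  shows "half_plane_normalized 1 (\<lambda>z. f z x) \<and> half_plane_normalized 0 (\<lambda>z. g z x)"
proof -
  obtain Aq Lq B1 M1 where cq: "continuous_on UNIV q"
    and Aq: "\<forall>x. (Aq has_real_derivative norm (q x)) (at x)" "\<forall>x. \<bar>Aq x\<bar> \<le> Lq"
    and "continuous_on UNIV B1" "mono B1" "\<forall>x. \<bar>B1 x\<bar> \<le> M1"
      "\<forall>x y c. x \<le> y \<longrightarrow> 0 < c \<longrightarrow> 2 * norm (q y - q x) \<le> c * (y - x) + (B1 y - B1 x) / c"
    by (rule admissible_potentialE[OF q])
  obtain Ap Lp B M where cp: "continuous_on UNIV p"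
    and Ap: "\<forall>x. (Ap has_real_derivative norm (p x)) (at x)" "\<forall>x. \<bar>Ap x\<bar> \<le> Lp"
    and B: "continuous_on UNIV B" "mono B" "\<forall>x. \<bar>B x\<bar> \<le> M"
    and m: "\<forall>x y c. x \<le> y \<longrightarrow> 0 < c \<longrightarrow> 2 * norm (p y - p x) \<le> c * (y - x) + (B y - B x) / c"
    by (rule admissible_potentialE[OF p])
  obtain P0 where P0: "\<And>x. norm (p x) \<le> P0" using admissible_bounded[OF p] by blast
  define A0 where "A0 x = Aq x + Ap x" for x
  have A0: "(A0 has_real_derivative norm (q x) + norm (p x)) (at x)" for x
    unfolding A0_def by (intro DERIV_add Aq(1)[rule_format] Ap(1)[rule_format])
  have A0_le: "\<bar>A0 x\<bar> \<le> Lq + Lp" for x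
    using Aq(2)[rule_format, of x] Ap(2)[rule_format, of x] by (simp add: A0_def)
  have "mono A0"
    by (intro monoI, rule DERIV_nonneg_imp_nondecreasing) (use A0 in \<open>auto intro!: exI add_nonneg_nonneg\<close>)
  from bounded_mono_limit_at_bot[OF this A0_le]
  obtain l where l: "(A0 \<longlongrightarrow> l) at_bot" "\<bar>l\<bar> \<le> Lq + Lp" by blast
  interpret regular_jost_normal_form q p "\<lambda>x. A0 x - l" "(Lq + Lp) + (Lq + Lp)" f g B M P0
  proof
    show "((\<lambda>x. A0 x - l) has_real_derivative norm (q x) + norm (p x)) (at x)" for x
      using DERIV_diff[OF A0 DERIV_const] by simp
    show "((\<lambda>x. A0 x - l) \<longlongrightarrow> 0) at_bot"
      using tendsto_diff[OF l(1) tendsto_const[of l]] by simp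
    show "A0 x - l \<le> (Lq + Lp) + (Lq + Lp)" for x
      using A0_le[of x] l(2) by linarith
  qed (use cq cp f_deriv g_deriv f_at_bot g_at_bot B m P0 in auto)
  have O: "h \<in> O[inf at_infinity (principal {z. \<delta> \<le> Im z})](\<lambda>z. 1 / z)"
    if "\<And>z. \<delta> \<le> Im z \<Longrightarrow> norm (h z) \<le> C / norm z" for h :: "complex \<Rightarrow> complex" and C \<delta>
    using that by (intro bigoI[of _ C]) (auto simp: eventually_inf_principal norm_divide intro!: always_eventually)
  have f_rate: "(\<lambda>z. f z x - 1) \<in> O[inf at_infinity (principal {z. \<delta> \<le> Im z})](\<lambda>z. 1 / z)" if "0 < \<delta>" for \<delta>
    using jost_rate(2)[OF that]
    by (intro O[where C = "decay_const * (1 + 1 / (2 * \<delta>)) * ((Lq + Lp) + (Lq + Lp))"]) (simp add: mult.commute)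
  have F: "half_plane_normalized 1 (\<lambda>z. f z x)"
    unfolding half_plane_normalized_def
    using holomorphic_jost(1) continuous_jost_spectral(1) jost_limit(1) f_rate by blast
  have g_rate: "(\<lambda>z. g z x - 0) \<in> O[inf at_infinity (principal {z. \<delta> \<le> Im z})](\<lambda>z. 1 / z)" if "0 < \<delta>" for \<delta>
    using jost_rate(1)[OF that] by (intro O) simp
  have G: "half_plane_normalized 0 (\<lambda>z. g z x)"
    unfolding half_plane_normalized_def
    using holomorphic_jost(2) continuous_jost_spectral(2) jost_limit(2) g_rate by blast
  show ?thesis using F G by (rule conjI)
qed

section \<open>Assembling a Riemann-Hilbert problem from two half planes\<close>

lemma norm_matrix2_le:
  fixes A :: "complex^2^2"
  shows "norm A \<le> norm (A $ 1 $ 1) + norm (A $ 1 $ 2) + (norm (A $ 2 $ 1) + norm (A $ 2 $ 2))"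
proof -
  have v: "norm v \<le> norm (v $ 1) + norm (v $ 2)" for v :: "'a::real_normed_vector^2"
    using L2_set_le_sum[of UNIV "\<lambda>i. norm (v $ i)"] by (simp add: norm_vec_def sum_2)
  show ?thesis using v[of A] v[of "A $ 1"] v[of "A $ 2"] by linarith
qed

lemma tendsto_matrix:
  fixes M :: "'a \<Rightarrow> complex^2^2"
  assumes "\<And>i j. ((\<lambda>z. M z $ i $ j) \<longlongrightarrow> L $ i $ j) F"
  shows "(M \<longlongrightarrow> L) F"
  by (intro vec_tendstoI assms)

text \<open>
  Functions on the lower half plane are described by their composition with \<open>z \<mapsto> - z\<close>, so that one notion
  of normalization serves both half planes.
\<close>

lemma solves_RHP_half_planes:
  fixes h k :: "2 \<Rightarrow> 2 \<Rightarrow> complex \<Rightarrow> complex"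
  assumes h: "\<And>i j. half_plane_normalized (mat 1 $ i $ j) (h i j)"
    and k: "\<And>i j. half_plane_normalized (mat 1 $ i $ j) (k i j)"
    and Mh: "\<And>i j z. 0 < Im z \<Longrightarrow> M z $ i $ j = h i j z"
    and Mk: "\<And>i j z. Im z < 0 \<Longrightarrow> M z $ i $ j = k i j (- z)"
    and jump: "\<And>s::real. (\<chi> i j. h i j (of_real s)) = (\<chi> i j. k i j (- of_real s)) ** V s"
  shows "solves_RHP V M"
proof -
  note hD = half_plane_normalizedD[OF h] and kD = half_plane_normalizedD[OF k]
  have hol: "(\<lambda>z. M z $ i $ j) holomorphic_on {z. Im z \<noteq> 0}" for i j
  proof -
    have "(\<lambda>z. k i j (- z)) holomorphic_on {z. Im z < 0}"
      by (rule holomorphic_on_compose_gen[OF _ kD(1), unfolded o_def]) (auto intro!: holomorphic_intros)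
    then have "(\<lambda>z. M z $ i $ j) holomorphic_on {z. Im z < 0}"
      by (rule holomorphic_transform) (simp add: Mk)
    moreover have "(\<lambda>z. M z $ i $ j) holomorphic_on {z. 0 < Im z}"
      using hD(1) by (rule holomorphic_transform) (simp add: Mh)
    moreover have "{z. Im z \<noteq> 0} = {z. Im z < 0} \<union> {z. 0 < Im z}" by auto
    ultimately show ?thesis
      by (simp add: holomorphic_on_Un open_halfspace_Im_lt open_halfspace_Im_gt)
  qed
  have lim: "((\<lambda>z. M z $ i $ j) \<longlongrightarrow> mat 1 $ i $ j) (inf at_infinity (principal {z. Im z \<noteq> 0}))" for i j
  proof (rule tendstoI)
    fix e :: real assume e: "0 < e"
    obtain b1 where b1: "\<And>z. b1 \<le> norm z \<Longrightarrow> 0 \<le> Im z \<Longrightarrow> dist (h i j z) (mat 1 $ i $ j) < e"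
      using tendstoD[OF hD(3)[of i j] e] unfolding eventually_inf_principal eventually_at_infinity by blast
    obtain b2 where b2: "\<And>z. b2 \<le> norm z \<Longrightarrow> 0 \<le> Im z \<Longrightarrow> dist (k i j z) (mat 1 $ i $ j) < e"
      using tendstoD[OF kD(3)[of i j] e] unfolding eventually_inf_principal eventually_at_infinity by blast
    have "dist (M z $ i $ j) (mat 1 $ i $ j) < e" if "max b1 b2 \<le> norm z" "Im z \<noteq> 0" for z
      using b1[of z] b2[of "- z"] that Mh[of z] Mk[of z] by (cases "0 < Im z") auto
    then show "\<forall>\<^sub>F z in inf at_infinity (principal {z. Im z \<noteq> 0}). dist (M z $ i $ j) (mat 1 $ i $ j) < e"
      unfolding eventually_inf_principal eventually_at_infinity by blast
  qed
  have rate: "\<exists>C b. \<forall>z. b \<le> norm z \<longrightarrow> \<delta> \<le> \<bar>Im z\<bar> \<longrightarrow> norm (M z $ i $ j - mat 1 $ i $ j) \<le> C * norm (1 / z)"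
    if \<delta>: "0 < \<delta>" for \<delta> i j
  proof -
    obtain C1 where "\<forall>\<^sub>F z in inf at_infinity (principal {z. \<delta> \<le> Im z}). norm (h i j z - mat 1 $ i $ j) \<le> C1 * norm (1 / z)"
      using hD(4)[OF \<delta>] by (rule landau_o.bigE)
    then obtain b1 where b1: "\<And>z. b1 \<le> norm z \<Longrightarrow> \<delta> \<le> Im z \<Longrightarrow> norm (h i j z - mat 1 $ i $ j) \<le> C1 * norm (1 / z)"
      unfolding eventually_inf_principal eventually_at_infinity by blast
    obtain C2 where "\<forall>\<^sub>F z in inf at_infinity (principal {z. \<delta> \<le> Im z}). norm (k i j z - mat 1 $ i $ j) \<le> C2 * norm (1 / z)"
      using kD(4)[OF \<delta>] by (rule landau_o.bigE)
    then obtain b2 where b2: "\<And>z. b2 \<le> norm z \<Longrightarrow> \<delta> \<le> Im z \<Longrightarrow> norm (k i j z - mat 1 $ i $ j) \<le> C2 * norm (1 / z)"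
      unfolding eventually_inf_principal eventually_at_infinity by blast
    have "norm (M z $ i $ j - mat 1 $ i $ j) \<le> max C1 C2 * norm (1 / z)"
      if z: "max b1 b2 \<le> norm z" "\<delta> \<le> \<bar>Im z\<bar>" for z
    proof (cases "0 < Im z")
      case True
      then have "norm (M z $ i $ j - mat 1 $ i $ j) \<le> C1 * norm (1 / z)"
        using b1[of z] z Mh[of z] by auto
      also have "\<dots> \<le> max C1 C2 * norm (1 / z)" by (intro mult_right_mono) auto
      finally show ?thesis .
    next
      case False
      then have "norm (M z $ i $ j - mat 1 $ i $ j) \<le> C2 * norm (1 / z)"
        using b2[of "- z"] z \<delta> Mk[of z] by auto
      also have "\<dots> \<le> max C1 C2 * norm (1 / z)" by (intro mult_right_mono) auto
      finally show ?thesis .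
    qed
    then show ?thesis by blast
  qed
  have bigo: "(\<lambda>z. norm (M z - mat 1)) \<in> O[inf at_infinity (principal {z. \<delta> \<le> \<bar>Im z\<bar>})](\<lambda>z. norm (1 / z))"
    if \<delta>: "0 < \<delta>" for \<delta>
  proof -
    have entry: "(\<lambda>z. norm ((M z - mat 1) $ i $ j)) \<in> O[inf at_infinity (principal {z. \<delta> \<le> \<bar>Im z\<bar>})](\<lambda>z. norm (1 / z))" for i j
    proof -
      obtain C b where "\<forall>z. b \<le> norm z \<longrightarrow> \<delta> \<le> \<bar>Im z\<bar> \<longrightarrow> norm (M z $ i $ j - mat 1 $ i $ j) \<le> C * norm (1 / z)"
        using rate[OF \<delta>] by blast
      then show ?thesis
        by (intro bigoI[of _ C]) (auto simp: eventually_inf_principal eventually_at_infinity)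
    qed
    have "(\<lambda>z. norm (M z - mat 1)) \<in> O[inf at_infinity (principal {z. \<delta> \<le> \<bar>Im z\<bar>})](\<lambda>z.
        norm ((M z - mat 1) $ 1 $ 1) + norm ((M z - mat 1) $ 1 $ 2)
        + (norm ((M z - mat 1) $ 2 $ 1) + norm ((M z - mat 1) $ 2 $ 2)))"
      proof (intro landau_o.big_mono always_eventually allI)
      show "norm (norm (M z - mat 1)) \<le> norm (norm ((M z - mat 1) $ 1 $ 1) + norm ((M z - mat 1) $ 1 $ 2)
        + (norm ((M z - mat 1) $ 2 $ 1) + norm ((M z - mat 1) $ 2 $ 2)))" for z
        using norm_matrix2_le[of "M z - mat 1"] by (simp only: real_norm_def abs_of_nonneg add_nonneg_nonneg norm_ge_zero)
    qed
    also have "(\<lambda>z. norm ((M z - mat 1) $ 1 $ 1) + norm ((M z - mat 1) $ 1 $ 2)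
        + (norm ((M z - mat 1) $ 2 $ 1) + norm ((M z - mat 1) $ 2 $ 2)))
        \<in> O[inf at_infinity (principal {z. \<delta> \<le> \<bar>Im z\<bar>})](\<lambda>z. norm (1 / z))"
      by (intro sum_in_bigo(1) entry)
    finally show ?thesis .
  qed
  have upper: "(M \<longlongrightarrow> (\<chi> i j. h i j (of_real s))) (at (of_real s) within {z. 0 < Im z})" for s
  proof (rule tendsto_matrix)
    fix i j
    have "(h i j \<longlongrightarrow> h i j (of_real s)) (at (of_real s) within {z. 0 \<le> Im z})"
      using hD(2)[of i j] by (auto simp: continuous_on)
    then have "(h i j \<longlongrightarrow> h i j (of_real s)) (at (of_real s) within {z. 0 < Im z})"
      by (rule tendsto_within_subset) auto
    moreover have "\<forall>\<^sub>F z in at (of_real s) within {z. 0 < Im z}. h i j z = M z $ i $ j"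
      by (simp add: eventually_at_topological Mh) blast
    ultimately show "((\<lambda>z. M z $ i $ j) \<longlongrightarrow> (\<chi> i j. h i j (of_real s)) $ i $ j) (at (of_real s) within {z. 0 < Im z})"
      by (simp add: tendsto_cong)
  qed
  have lower: "(M \<longlongrightarrow> (\<chi> i j. k i j (- of_real s))) (at (of_real s) within {z. Im z < 0})" for s
  proof (rule tendsto_matrix)
    fix i j
    have "continuous_on {z. Im z \<le> 0} (\<lambda>z. k i j (- z))"
      by (rule continuous_on_compose2[OF kD(2)]) (auto intro: continuous_intros)
    then have "((\<lambda>z. k i j (- z)) \<longlongrightarrow> k i j (- of_real s)) (at (of_real s) within {z. Im z \<le> 0})"
      by (auto simp: continuous_on)
    then have "((\<lambda>z. k i j (- z)) \<longlongrightarrow> k i j (- of_real s)) (at (of_real s) within {z. Im z < 0})"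
      by (rule tendsto_within_subset) auto
    moreover have "\<forall>\<^sub>F z in at (of_real s) within {z. Im z < 0}. k i j (- z) = M z $ i $ j"
      by (simp add: eventually_at_topological Mk) blast
    ultimately show "((\<lambda>z. M z $ i $ j) \<longlongrightarrow> (\<chi> i j. k i j (- of_real s)) $ i $ j) (at (of_real s) within {z. Im z < 0})"
      by (simp add: tendsto_cong)
  qed
  have boundary: "\<exists>Mp Mm. \<forall>s::real.
      (M \<longlongrightarrow> Mp s) (at (of_real s) within {z. Im z > 0}) \<and>
      (M \<longlongrightarrow> Mm s) (at (of_real s) within {z. Im z < 0}) \<and> Mp s = Mm s ** V s"
    using upper lower jump
    by (intro exI[of _ "\<lambda>s. \<chi> i j. h i j (of_real s)"] exI[of _ "\<lambda>s. \<chi> i j. k i j (- of_real s)"]) simp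
  have limit: "(M \<longlongrightarrow> mat 1) (inf at_infinity (principal {z. Im z \<noteq> 0}))"
    using lim by (rule tendsto_matrix)
  show ?thesis
    unfolding solves_RHP_def using hol limit bigo boundary by blast
qed

section \<open>The Jost columns in normal form\<close>

lemmas matrix2_simps = mat2_def sigma3_def exp_sigma3_def of_cols_def Qmat_def column_def
  matrix_vector_mult_def matrix_matrix_mult_def mat_def sum_2 vector_2

lemma modified_entries:
  "modified \<phi> z x t $ i $ 1 = \<phi> z x t $ i $ 1 * exp (phase z x t)"
  "modified \<phi> z x t $ i $ 2 = \<phi> z x t $ i $ 2 * exp (- phase z x t)"
  by (simp_all add: modified_def matrix2_simps)

lemma lax_column_derivative:
  assumes "lax_pair_solution \<sigma> J q z (\<lambda>x t. column j (\<phi> z x t))" and "t \<in> J"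
  shows "((\<lambda>y. \<phi> z y t $ 1 $ j) has_vector_derivative
           q x t * \<phi> z x t $ 2 $ j - \<i> * z * \<phi> z x t $ 1 $ j) (at x)"
    and "((\<lambda>y. \<phi> z y t $ 2 $ j) has_vector_derivative
           - of_real \<sigma> * cnj (q (- x) t) * \<phi> z x t $ 1 $ j + \<i> * z * \<phi> z x t $ 2 $ j) (at x)"
proof -
  have "((\<lambda>y. column j (\<phi> z y t)) has_vector_derivative
      ((Qmat \<sigma> q x t - mat (\<i> * z) ** sigma3) *v column j (\<phi> z x t))) (at x)"
    using assms unfolding lax_pair_solution_def by blast
  then have "((\<lambda>y. column j (\<phi> z y t) $ i) has_vector_derivative
      ((Qmat \<sigma> q x t - mat (\<i> * z) ** sigma3) *v column j (\<phi> z x t)) $ i) (at x)" for i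
    by (rule bounded_linear.has_vector_derivative[OF bounded_linear_vec_nth])
  from this[of 1] this[of 2]
  show "((\<lambda>y. \<phi> z y t $ 1 $ j) has_vector_derivative
           q x t * \<phi> z x t $ 2 $ j - \<i> * z * \<phi> z x t $ 1 $ j) (at x)"
    and "((\<lambda>y. \<phi> z y t $ 2 $ j) has_vector_derivative
           - of_real \<sigma> * cnj (q (- x) t) * \<phi> z x t $ 1 $ j + \<i> * z * \<phi> z x t $ 2 $ j) (at x)"
    by (simp_all add: matrix2_simps)
qed

lemma exp_phase_derivative:
  "((\<lambda>y. exp (phase z y t)) has_vector_derivative \<i> * z * exp (phase z x t)) (at x)"
  "((\<lambda>y. exp (- phase z y t)) has_vector_derivative - (\<i> * z * exp (- phase z x t))) (at x)"
  unfolding phase_def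
  by (rule has_vector_derivative_eq_rhs, rule has_vector_derivative_real_field,
      (rule derivative_eq_intros refl)+, simp)+

text \<open>
  The exponential factor moves the diagonal term \<open>- i z \<sigma>\<^sub>3\<close> of the equation entirely into the entry that
  tends to \<open>0\<close>: the second one here, the first one for the other column.
\<close>

lemma modified_column1_derivative:
  assumes "lax_pair_solution \<sigma> J q z (\<lambda>x t. column 1 (\<phi> z x t))" and "t \<in> J"
  shows "((\<lambda>y. modified \<phi> z y t $ 1 $ 1) has_vector_derivative
           q x t * modified \<phi> z x t $ 2 $ 1) (at x)"
    and "((\<lambda>y. modified \<phi> z y t $ 2 $ 1) has_vector_derivative
           - of_real \<sigma> * cnj (q (- x) t) * modified \<phi> z x t $ 1 $ 1 + 2 * \<i> * z * modified \<phi> z x t $ 2 $ 1) (at x)"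
  unfolding modified_entries
  by (rule has_vector_derivative_eq_rhs[OF has_vector_derivative_mult[OF
        lax_column_derivative(1)[where \<phi> = \<phi> and z = z and j = 1, OF assms] exp_phase_derivative(1)]]
      has_vector_derivative_eq_rhs[OF has_vector_derivative_mult[OF
        lax_column_derivative(2)[where \<phi> = \<phi> and z = z and j = 1, OF assms] exp_phase_derivative(1)]]; simp add: algebra_simps)+

lemma modified_column2_derivative:
  assumes "lax_pair_solution \<sigma> J q z (\<lambda>x t. column 2 (\<phi> z x t))" and "t \<in> J"
  shows "((\<lambda>y. modified \<phi> z y t $ 1 $ 2) has_vector_derivative
           q x t * modified \<phi> z x t $ 2 $ 2 - 2 * \<i> * z * modified \<phi> z x t $ 1 $ 2) (at x)"
    and "((\<lambda>y. modified \<phi> z y t $ 2 $ 2) has_vector_derivative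
           - of_real \<sigma> * cnj (q (- x) t) * modified \<phi> z x t $ 1 $ 2) (at x)"
  unfolding modified_entries
  by (rule has_vector_derivative_eq_rhs[OF has_vector_derivative_mult[OF
        lax_column_derivative(1)[where \<phi> = \<phi> and z = z and j = 2, OF assms] exp_phase_derivative(2)]]
      has_vector_derivative_eq_rhs[OF has_vector_derivative_mult[OF
        lax_column_derivative(2)[where \<phi> = \<phi> and z = z and j = 2, OF assms] exp_phase_derivative(2)]]; simp add: algebra_simps)+

lemma jost_column_limit:
  assumes "jost_column \<sigma> J q \<phi> j F D" "z \<in> D" "t \<in> J"
  shows "((\<lambda>x. modified \<phi> z x t $ i $ j) \<longlongrightarrow> (if i = j then 1 else 0)) F"
proof -
  have "((\<lambda>x. column j (modified \<phi> z x t)) \<longlongrightarrow> axis j 1) F"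
    using assms unfolding jost_column_def by blast
  from tendsto_vec_nth[OF this, of i] show ?thesis
    by (simp add: column_def axis_def eq_commute)
qed

lemma has_vector_derivative_reflect:
  fixes u :: "real \<Rightarrow> complex"
  assumes "\<And>x. (u has_vector_derivative u' x) (at x)"
  shows "((\<lambda>x. u (- x)) has_vector_derivative - u' (- x)) (at x)"
proof -
  have "(uminus has_vector_derivative -1) (at x)" for x :: real
    by (auto simp: has_real_derivative_iff_has_vector_derivative[symmetric] intro!: derivative_eq_intros)
  from vector_diff_chain_at[OF this assms] show ?thesis by (simp add: o_def)
qed

lemma tendsto_reflect:
  assumes "(u \<longlongrightarrow> l) at_top" shows "((\<lambda>x::real. u (- x)) \<longlongrightarrow> l) at_bot"
  using assms filterlim_uminus_at_top_at_bot by (rule filterlim_compose)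

text \<open>
  The normal form takes the entry tending to \<open>1\<close> as \<open>f\<close> and the other one as \<open>g\<close>.  Its potentials
  are \<open>u, p\<close> and \<open>p, u\<close> for the two columns of \<open>\<phi>m\<close>, and \<open>- u(- x), - p(- x)\<close> and
  \<open>- p(- x), - u(- x)\<close> for those of \<open>\<phi>p\<close>, the sign being that of the reflected derivative.
\<close>

lemma half_plane_normalized_columns:
  fixes t :: real
  assumes "H11 (\<lambda>x. q x t)" and "\<sigma> \<in> {1, -1}" and jost: "jost_solutions \<sigma> J q \<phi>m \<phi>p" and t: "t \<in> J"
  shows "half_plane_normalized (if i = 1 then 1 else 0) (\<lambda>z. modified \<phi>m z x t $ i $ 1)"
    and "half_plane_normalized (if i = 2 then 1 else 0) (\<lambda>z. modified \<phi>p z x t $ i $ 2)"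
    and "half_plane_normalized (if i = 1 then 1 else 0) (\<lambda>z. modified \<phi>p (- z) x t $ i $ 1)"
    and "half_plane_normalized (if i = 2 then 1 else 0) (\<lambda>z. modified \<phi>m (- z) x t $ i $ 2)"
proof -
  define u where "u x = q x t" for x
  define p where "p x = - of_real \<sigma> * cnj (q (- x) t)" for x
  have u: "admissible_potential u" using admissible_H11[OF assms(1)] by (simp add: u_def[abs_def])
  have norm_p: "norm (p x) = norm (u (- x))" "norm (p x - p y) = norm (u (- x) - u (- y))" for x y
  proof -
    have "norm (of_real \<sigma> :: complex) = 1" using assms(2) by auto
    moreover have "p x - p y = - of_real \<sigma> * cnj (u (- x) - u (- y))"
      by (simp add: p_def u_def algebra_simps)
    ultimately show "norm (p x) = norm (u (- x))" "norm (p x - p y) = norm (u (- x) - u (- y))"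
      by (simp_all add: p_def u_def norm_mult del: complex_cnj_diff)
  qed
  have p: "admissible_potential p"
    by (rule admissible_isometry[OF admissible_reflection[OF u]]) (rule norm_p)+
  have u': "admissible_potential (\<lambda>x. - u (- x))" and p': "admissible_potential (\<lambda>x. - p (- x))"
    by (rule admissible_isometry[OF admissible_reflection[OF u]] admissible_isometry[OF admissible_reflection[OF p]];
        simp add: norm_minus_commute)+
  have m1: "jost_column \<sigma> J q \<phi>m 1 at_bot {z. Im z \<ge> 0}" and m2: "jost_column \<sigma> J q \<phi>m 2 at_bot {z. Im z \<le> 0}"
    and p1: "jost_column \<sigma> J q \<phi>p 1 at_top {z. Im z \<le> 0}" and p2: "jost_column \<sigma> J q \<phi>p 2 at_top {z. Im z \<ge> 0}"
    using jost unfolding jost_solutions_def by blast+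
  have lax: "lax_pair_solution \<sigma> J q z (\<lambda>x t. column j (\<phi> z x t))"
    if "jost_column \<sigma> J q \<phi> j F D" "z \<in> D" for \<phi> j F D z
    using that unfolding jost_column_def by blast

  have "half_plane_normalized 1 (\<lambda>z. modified \<phi>m z x t $ 1 $ 1) \<and> half_plane_normalized 0 (\<lambda>z. modified \<phi>m z x t $ 2 $ 1)"
  proof (rule half_plane_normalized_jost[where q = u and p = p
        and f = "\<lambda>z x. modified \<phi>m z x t $ 1 $ 1" and g = "\<lambda>z x. modified \<phi>m z x t $ 2 $ 1"])
    fix z x assume z: "0 \<le> Im z"
    show "((\<lambda>x. modified \<phi>m z x t $ 1 $ 1) has_vector_derivative u x * modified \<phi>m z x t $ 2 $ 1) (at x)"
      "((\<lambda>x. modified \<phi>m z x t $ 2 $ 1) has_vector_derivative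
          p x * modified \<phi>m z x t $ 1 $ 1 + 2 * \<i> * z * modified \<phi>m z x t $ 2 $ 1) (at x)"
      using modified_column1_derivative[where \<phi> = \<phi>m and z = z, OF lax[OF m1] t] z unfolding u_def p_def by auto
    show "((\<lambda>x. modified \<phi>m z x t $ 1 $ 1) \<longlongrightarrow> 1) at_bot" "((\<lambda>x. modified \<phi>m z x t $ 2 $ 1) \<longlongrightarrow> 0) at_bot"
      using jost_column_limit[OF m1 _ t, of z 1] jost_column_limit[OF m1 _ t, of z 2] z by auto
  qed (rule u p)+
  then show "half_plane_normalized (if i = 1 then 1 else 0) (\<lambda>z. modified \<phi>m z x t $ i $ 1)"
    using exhaust_2[of i] by auto

  have "half_plane_normalized 1 (\<lambda>z. modified \<phi>m (- z) x t $ 2 $ 2) \<and> half_plane_normalized 0 (\<lambda>z. modified \<phi>m (- z) x t $ 1 $ 2)"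
  proof (rule half_plane_normalized_jost[where q = p and p = u
        and f = "\<lambda>z x. modified \<phi>m (- z) x t $ 2 $ 2" and g = "\<lambda>z x. modified \<phi>m (- z) x t $ 1 $ 2"])
    fix z x assume z: "0 \<le> Im z"
    show "((\<lambda>x. modified \<phi>m (- z) x t $ 2 $ 2) has_vector_derivative p x * modified \<phi>m (- z) x t $ 1 $ 2) (at x)"
      "((\<lambda>x. modified \<phi>m (- z) x t $ 1 $ 2) has_vector_derivative
          u x * modified \<phi>m (- z) x t $ 2 $ 2 + 2 * \<i> * z * modified \<phi>m (- z) x t $ 1 $ 2) (at x)"
      using modified_column2_derivative[where \<phi> = \<phi>m and z = "- z", OF lax[OF m2] t] z unfolding u_def p_def by auto
    show "((\<lambda>x. modified \<phi>m (- z) x t $ 2 $ 2) \<longlongrightarrow> 1) at_bot" "((\<lambda>x. modified \<phi>m (- z) x t $ 1 $ 2) \<longlongrightarrow> 0) at_bot"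
      using jost_column_limit[OF m2 _ t, of "- z" 2] jost_column_limit[OF m2 _ t, of "- z" 1] z by auto
  qed (rule u p)+
  then show "half_plane_normalized (if i = 2 then 1 else 0) (\<lambda>z. modified \<phi>m (- z) x t $ i $ 2)"
    using exhaust_2[of i] by auto

  \<comment> \<open>The double negation lets the reflected family be evaluated at the point \<open>- x\<close>.\<close>
  have "half_plane_normalized 1 (\<lambda>z. modified \<phi>p z (- (- x)) t $ 2 $ 2) \<and> half_plane_normalized 0 (\<lambda>z. modified \<phi>p z (- (- x)) t $ 1 $ 2)"
  proof (rule half_plane_normalized_jost[where q = "\<lambda>x. - p (- x)" and p = "\<lambda>x. - u (- x)"
        and f = "\<lambda>z x. modified \<phi>p z (- x) t $ 2 $ 2" and g = "\<lambda>z x. modified \<phi>p z (- x) t $ 1 $ 2"])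
    fix z x assume z: "0 \<le> Im z"
    show "((\<lambda>x. modified \<phi>p z (- x) t $ 2 $ 2) has_vector_derivative - p (- x) * modified \<phi>p z (- x) t $ 1 $ 2) (at x)"
      "((\<lambda>x. modified \<phi>p z (- x) t $ 1 $ 2) has_vector_derivative
          - u (- x) * modified \<phi>p z (- x) t $ 2 $ 2 + 2 * \<i> * z * modified \<phi>p z (- x) t $ 1 $ 2) (at x)"
      using has_vector_derivative_reflect[OF modified_column2_derivative(1)[where \<phi> = \<phi>p and z = z, OF lax[OF p2] t]]
        has_vector_derivative_reflect[OF modified_column2_derivative(2)[where \<phi> = \<phi>p and z = z, OF lax[OF p2] t]] z
      unfolding u_def p_def by auto
    show "((\<lambda>x. modified \<phi>p z (- x) t $ 2 $ 2) \<longlongrightarrow> 1) at_bot" "((\<lambda>x. modified \<phi>p z (- x) t $ 1 $ 2) \<longlongrightarrow> 0) at_bot"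
      using tendsto_reflect[OF jost_column_limit[OF p2 _ t, of z 2]] tendsto_reflect[OF jost_column_limit[OF p2 _ t, of z 1]] z by auto
  qed (rule u' p')+
  then show "half_plane_normalized (if i = 2 then 1 else 0) (\<lambda>z. modified \<phi>p z x t $ i $ 2)"
    using exhaust_2[of i] by auto

  have "half_plane_normalized 1 (\<lambda>z. modified \<phi>p (- z) (- (- x)) t $ 1 $ 1) \<and> half_plane_normalized 0 (\<lambda>z. modified \<phi>p (- z) (- (- x)) t $ 2 $ 1)"
  proof (rule half_plane_normalized_jost[where q = "\<lambda>x. - u (- x)" and p = "\<lambda>x. - p (- x)"
        and f = "\<lambda>z x. modified \<phi>p (- z) (- x) t $ 1 $ 1" and g = "\<lambda>z x. modified \<phi>p (- z) (- x) t $ 2 $ 1"])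
    fix z x assume z: "0 \<le> Im z"
    show "((\<lambda>x. modified \<phi>p (- z) (- x) t $ 1 $ 1) has_vector_derivative - u (- x) * modified \<phi>p (- z) (- x) t $ 2 $ 1) (at x)"
      "((\<lambda>x. modified \<phi>p (- z) (- x) t $ 2 $ 1) has_vector_derivative
          - p (- x) * modified \<phi>p (- z) (- x) t $ 1 $ 1 + 2 * \<i> * z * modified \<phi>p (- z) (- x) t $ 2 $ 1) (at x)"
      using has_vector_derivative_reflect[OF modified_column1_derivative(1)[where \<phi> = \<phi>p and z = "- z", OF lax[OF p1] t]]
        has_vector_derivative_reflect[OF modified_column1_derivative(2)[where \<phi> = \<phi>p and z = "- z", OF lax[OF p1] t]] z
      unfolding u_def p_def by (auto simp: add.commute)
    show "((\<lambda>x. modified \<phi>p (- z) (- x) t $ 1 $ 1) \<longlongrightarrow> 1) at_bot" "((\<lambda>x. modified \<phi>p (- z) (- x) t $ 2 $ 1) \<longlongrightarrow> 0) at_bot"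
      using tendsto_reflect[OF jost_column_limit[OF p1 _ t, of "- z" 1]] tendsto_reflect[OF jost_column_limit[OF p1 _ t, of "- z" 2]] z by auto
  qed (rule u' p')+
  then show "half_plane_normalized (if i = 1 then 1 else 0) (\<lambda>z. modified \<phi>p (- z) x t $ i $ 1)"
    using exhaust_2[of i] by auto
qed

section \<open>The jump condition\<close>

text \<open>
  Inserting \<open>\<phi>m = \<phi>p S\<close>, both columns on the left become combinations of the columns of \<open>\<phi>p\<close>, and the
  entries of the jump matrix carry exactly the exponentials by which the modified columns differ.
\<close>

lemma jump_relation:
  assumes scat: "\<phi>m (of_real s) x t = \<phi>p (of_real s) x t ** mat2 a bb b ab"
    and nz: "a \<noteq> 0" "ab \<noteq> 0"
    and rho: "r s = b / a" "rb s = bb / ab"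
  shows "of_cols ((1 / a) *s column 1 (modified \<phi>m (of_real s) x t)) (column 2 (modified \<phi>p (of_real s) x t))
    = of_cols (column 1 (modified \<phi>p (of_real s) x t)) ((1 / ab) *s column 2 (modified \<phi>m (of_real s) x t))
      ** jump_matrix r rb s x t"
proof -
  define e where "e = exp (phase (of_real s) x t)"
  have e: "e \<noteq> 0" "exp (phase (of_real s) x t) = e" "exp (- phase (of_real s) x t) = inverse e"
    by (simp_all add: e_def exp_minus)
  have "\<phi>m (of_real s) x t $ i $ 1 = \<phi>p (of_real s) x t $ i $ 1 * a + \<phi>p (of_real s) x t $ i $ 2 * b"
    "\<phi>m (of_real s) x t $ i $ 2 = \<phi>p (of_real s) x t $ i $ 1 * bb + \<phi>p (of_real s) x t $ i $ 2 * ab" for i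
    by (simp_all add: scat matrix2_simps)
  then show ?thesis
    using nz e(1)
    by (simp add: vec_eq_iff forall_2 jump_matrix_def exp_hat_sigma3_def matrix2_simps modified_entries e rho)
       (simp add: field_simps)
qed

theorem mainTheorem2:
  fixes \<sigma> :: real and J :: "real set"
    and q0 :: "real \<Rightarrow> complex" and q :: "real \<Rightarrow> real \<Rightarrow> complex"
    and \<phi>m \<phi>p :: "complex \<Rightarrow> real \<Rightarrow> real \<Rightarrow> complex^2^2"
    and a ab :: "complex \<Rightarrow> complex" and b bb :: "real \<Rightarrow> complex"
    and x t :: real
  assumes "\<sigma> \<in> {1, -1}"
    and "is_interval J" and "0 \<in> J"
    and "H11 q0"
    and "nonlocal_nls_solution \<sigma> J q0 q"
    and "jost_solutions \<sigma> J q \<phi>m \<phi>p"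
    and "scattering_data J \<phi>m \<phi>p a ab b bb"
    and "generic a ab"
    and "\<forall>z. Im z > 0 \<longrightarrow> a z \<noteq> 0"
    and "\<forall>z. Im z < 0 \<longrightarrow> ab z \<noteq> 0"
    and "t \<in> J"
  shows "solves_RHP (\<lambda>s. jump_matrix (reflection a b) (reflection ab bb) s x t)
                    (\<lambda>z. RH_matrix \<phi>m \<phi>p a ab z x t)"
proof -
  define m where "m z i j = modified \<phi>m z x t $ i $ j" for z i j
  define p where "p z i j = modified \<phi>p z x t $ i $ j" for z i j
  have "H11 (\<lambda>x. q x t)"
    using assms(5,11) unfolding nonlocal_nls_solution_def by blast
  note columns = half_plane_normalized_columns[OF this assms(1,6,11), of _ x, folded m_def p_def]
  define A where "A z = m z 1 1 * p z 2 2 - p z 1 2 * m z 2 1" for z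
  define AB where "AB z = p (- z) 1 1 * m (- z) 2 2 - m (- z) 1 2 * p (- z) 2 1" for z
  have hA: "half_plane_normalized 1 A"
    using half_plane_normalized_diff[OF
        half_plane_normalized_mult[OF columns(1)[of 1] columns(2)[of 2]]
        half_plane_normalized_mult[OF columns(2)[of 1] columns(1)[of 2]]]
    by (simp add: A_def[abs_def])
  have hAB: "half_plane_normalized 1 AB"
    using half_plane_normalized_diff[OF
        half_plane_normalized_mult[OF columns(3)[of 1] columns(4)[of 2]]
        half_plane_normalized_mult[OF columns(4)[of 1] columns(3)[of 2]]]
    by (simp add: AB_def[abs_def])
  have a_eq: "a z = A z" if "0 \<le> Im z" for z
  proof -
    have "a z = det (of_cols (column 1 (modified \<phi>m z x t)) (column 2 (modified \<phi>p z x t)))"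
      using assms(7,11) that unfolding scattering_data_def by blast
    then show ?thesis by (simp add: det_2 of_cols_def column_def A_def m_def p_def)
  qed
  have ab_eq: "ab z = AB (- z)" if "Im z \<le> 0" for z
  proof -
    have "ab z = det (of_cols (column 1 (modified \<phi>p z x t)) (column 2 (modified \<phi>m z x t)))"
      using assms(7,11) that unfolding scattering_data_def by blast
    then show ?thesis by (simp add: det_2 of_cols_def column_def AB_def m_def p_def)
  qed
  have real: "a (of_real s) \<noteq> 0" "ab (of_real s) \<noteq> 0" for s
    using assms(8) unfolding generic_def by blast+
  have A_nz: "A z \<noteq> 0" if "0 \<le> Im z" for z
    using real(1)[of "Re z"] assms(9) a_eq[OF that] that
    by (cases "Im z = 0") (auto simp: complex_is_Real_iff of_real_Re)
  have AB_nz: "AB z \<noteq> 0" if "0 \<le> Im z" for z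
    using real(2)[of "- Re z"] assms(10) ab_eq[of "- z"] that
    by (cases "Im z = 0") (auto simp: complex_is_Real_iff of_real_Re)
  define h where "h i j z = (if j = 1 then m z i 1 * (1 / A z) else p z i 2)" for i j :: 2 and z
  define k where "k i j z = (if j = 1 then p (- z) i 1 else m (- z) i 2 * (1 / AB z))" for i j :: 2 and z
  show ?thesis
  proof (rule solves_RHP_half_planes[where h = h and k = k])
    fix i j :: 2
    show "half_plane_normalized (mat 1 $ i $ j) (h i j)"
      using half_plane_normalized_mult[OF columns(1)[of i] half_plane_normalized_inverse[OF hA A_nz]]
        columns(2)[of i] exhaust_2[of j]
      by (auto simp: h_def[abs_def] mat_def)
    show "half_plane_normalized (mat 1 $ i $ j) (k i j)"
      using half_plane_normalized_mult[OF columns(4)[of i] half_plane_normalized_inverse[OF hAB AB_nz]]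
        columns(3)[of i] exhaust_2[of j]
      by (auto simp: k_def[abs_def] mat_def)
    fix z :: complex
    show "RH_matrix \<phi>m \<phi>p a ab z x t $ i $ j = h i j z" if "0 < Im z"
      using that a_eq[of z] by (simp add: RH_matrix_def h_def m_def p_def of_cols_def column_def)
    show "RH_matrix \<phi>m \<phi>p a ab z x t $ i $ j = k i j (- z)" if "Im z < 0"
      using that ab_eq[of z] by (simp add: RH_matrix_def k_def m_def p_def of_cols_def column_def)
  next
    fix s :: real
    have "\<phi>m (of_real s) x t = \<phi>p (of_real s) x t ** mat2 (a (of_real s)) (bb s) (b s) (ab (of_real s))"
      using assms(7,11) unfolding scattering_data_def by blast
    note jump_relation[where \<phi>m = \<phi>m and \<phi>p = \<phi>p and a = "a (of_real s)" and ab = "ab (of_real s)"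
        and b = "b s" and bb = "bb s" and r = "reflection a b" and rb = "reflection ab bb" and x = x and t = t,
        OF this real[of s] reflection_def reflection_def]
    moreover have "(\<chi> i j. h i j (of_real s)) = of_cols ((1 / a (of_real s)) *s column 1 (modified \<phi>m (of_real s) x t))
        (column 2 (modified \<phi>p (of_real s) x t))"
      using a_eq[of "of_real s"] by (simp add: vec_eq_iff h_def m_def p_def of_cols_def column_def)
    moreover have "(\<chi> i j. k i j (- of_real s)) = of_cols (column 1 (modified \<phi>p (of_real s) x t))
        ((1 / ab (of_real s)) *s column 2 (modified \<phi>m (of_real s) x t))"
      using ab_eq[of "of_real s"] by (simp add: vec_eq_iff k_def m_def p_def of_cols_def column_def)
    ultimately show "(\<chi> i j. h i j (of_real s)) =
        (\<chi> i j. k i j (- of_real s)) ** jump_matrix (reflection a b) (reflection ab bb) s x t"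
      by simp
  qed
qed

end
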